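(* Let $p$ be an odd prime, and let $S$ be a finite $p$-group such that the quotient $G = S/\mathfrak{X}(S)$ has nilpotence class at most $\log_2(p-2)+1$. Then $J_e(S) \leq \mathfrak{X}(S)$ (that is, Oliver's conjecture holds for $S$).
   Context: For a finite $p$-group $H$, $\Omega_1(H)$ is the subgroup generated by the elements of order $p$ in $H$. The Thompson subgroup $J_e(S)$ is the subgroup of $S$ generated by the elementary abelian subgroups of $S$ of maximum order. Commutators are left-normed: $[X,Y]$ is the subgroup generated by all commutators $[x,y]=x^{-1}y^{-1}xy$ with $x \in X$, $y\in Y$; $[X,Y;1]=[X,Y]$ and $[X,Y;n]=[[X,Y;n-1],Y]$. The Oliver subgroup $\mathfrak{X}(S)$ of a finite $p$-group $S$ ($p$ odd) is the largest subgroup of $S$ for which there exists a series $1 = Q_0 < Q_1 < \cdots < Q_n = \mathfrak{X}(S)$ with each $Q_i$ normal in $S$ and $[\Omega_1(C_S(Q_{i-1})), Q_i;\, p-1] = 1$ for all $1 \leq i \leq n$. (A largest such subgroup exists and is characteristic in $S$.) Oliver's conjecture for $S$ is the assertion $J_e(S) \leq \mathfrak{X}(S)$. *)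

theory Defs
  imports Complex_Main "HOL-Algebra.Generated_Groups" "HOL-Algebra.Zassenhaus" "HOL-Algebra.Multiplicative_Group" "HOL-Computational_Algebra.Primes"
begin

definition commutator_subgroup :: "('a, 'b) monoid_scheme \<Rightarrow> 'a set \<Rightarrow> 'a set \<Rightarrow> 'a set" where
  "commutator_subgroup G X Y =
     generate G (\<Union>x\<in>X. \<Union>y\<in>Y. {inv\<^bsub>G\<^esub> x \<otimes>\<^bsub>G\<^esub> inv\<^bsub>G\<^esub> y \<otimes>\<^bsub>G\<^esub> x \<otimes>\<^bsub>G\<^esub> y})"

(* The left-normed iterated commutator [X, Y; n], started at [X, Y; 0] = X,
   so that [X, Y; 1] = [X, Y]. *)
primrec iterated_commutator ::
    "('a, 'b) monoid_scheme \<Rightarrow> 'a set \<Rightarrow> 'a set \<Rightarrow> nat \<Rightarrow> 'a set" where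
  "iterated_commutator G X Y 0 = X"
| "iterated_commutator G X Y (Suc n) = commutator_subgroup G (iterated_commutator G X Y n) Y"

(* The n-th entry is gamma_{n+1}(G), because gamma_1(G) = G; thus G is nilpotent of class c
   iff c is the first index at which this series reaches the trivial subgroup. *)
definition lower_central_series :: "('a, 'b) monoid_scheme \<Rightarrow> nat \<Rightarrow> 'a set" where
  "lower_central_series G n = iterated_commutator G (carrier G) (carrier G) n"

definition nilpotent_of_class :: "('a, 'b) monoid_scheme \<Rightarrow> nat \<Rightarrow> bool" where
  "nilpotent_of_class G c \<longleftrightarrow>
     lower_central_series G c = {\<one>\<^bsub>G\<^esub>} \<and> (\<forall>k<c. lower_central_series G k \<noteq> {\<one>\<^bsub>G\<^esub>})"

definition centralizer :: "('a, 'b) monoid_scheme \<Rightarrow> 'a set \<Rightarrow> 'a set" where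
  "centralizer G H = {x \<in> carrier G. \<forall>h\<in>H. x \<otimes>\<^bsub>G\<^esub> h = h \<otimes>\<^bsub>G\<^esub> x}"

(* Omega_1(H) for a subgroup H of G, as a subset of G. *)
definition Omega1 :: "nat \<Rightarrow> ('a, 'b) monoid_scheme \<Rightarrow> 'a set \<Rightarrow> 'a set" where
  "Omega1 p G H = generate G {x \<in> H. group.ord G x = p}"

definition elementary_abelian_subgroup ::
    "nat \<Rightarrow> ('a, 'b) monoid_scheme \<Rightarrow> 'a set \<Rightarrow> bool" where
  "elementary_abelian_subgroup p G E \<longleftrightarrow>
     subgroup E G \<and> (\<forall>x\<in>E. \<forall>y\<in>E. x \<otimes>\<^bsub>G\<^esub> y = y \<otimes>\<^bsub>G\<^esub> x) \<and> (\<forall>x\<in>E. x [^]\<^bsub>G\<^esub> p = \<one>\<^bsub>G\<^esub>)"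

definition thompson_subgroup :: "nat \<Rightarrow> ('a, 'b) monoid_scheme \<Rightarrow> 'a set" where
  "thompson_subgroup p G =
     generate G (\<Union>{E. elementary_abelian_subgroup p G E \<and>
                       (\<forall>F. elementary_abelian_subgroup p G F \<longrightarrow> card F \<le> card E)})"

definition has_oliver_series :: "nat \<Rightarrow> ('a, 'b) monoid_scheme \<Rightarrow> 'a set \<Rightarrow> bool" where
  "has_oliver_series p S X \<longleftrightarrow>
     (\<exists>n Q. Q 0 = {\<one>\<^bsub>S\<^esub>} \<and> Q n = X \<and> (\<forall>i\<le>n. Q i \<lhd> S) \<and>
        (\<forall>i<n. Q i \<subset> Q (Suc i) \<and>
          iterated_commutator S (Omega1 p S (centralizer S (Q i))) (Q (Suc i)) (p - 1) =
            {\<one>\<^bsub>S\<^esub>}))"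

(* GREATEST is with respect to inclusion; the lemmas below show that, for finite S, the
   greatest element exists. *)
definition oliver_subgroup :: "nat \<Rightarrow> ('a, 'b) monoid_scheme \<Rightarrow> 'a set" where
  "oliver_subgroup p S = (GREATEST X. has_oliver_series p S X)"


lemma has_oliver_series_normal: "has_oliver_series p S X \<Longrightarrow> X \<lhd> S"
  unfolding has_oliver_series_def by blast

context group
begin

lemma inv_mult_cancel: "x \<in> carrier G \<Longrightarrow> y \<in> carrier G \<Longrightarrow> inv x \<otimes> (x \<otimes> y) = y"
  by (simp flip: m_assoc)

lemma mult_inv_cancel: "x \<in> carrier G \<Longrightarrow> y \<in> carrier G \<Longrightarrow> x \<otimes> (inv x \<otimes> y) = y"
  by (simp flip: m_assoc)

lemma set_mult_upper:
  assumes "subgroup H G" "subgroup K G"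
  shows "H \<subseteq> H <#> K" "K \<subseteq> H <#> K"
proof -
  have "h \<in> H <#> K" if "h \<in> H" for h
  proof -
    have "h = h \<otimes> \<one>" using that assms subgroup.mem_carrier by force
    then show ?thesis
      unfolding set_mult_def using that subgroup.one_closed[OF assms(2)] by blast
  qed
  moreover have "k \<in> H <#> K" if "k \<in> K" for k
  proof -
    have "k = \<one> \<otimes> k" using that assms subgroup.mem_carrier by force
    then show ?thesis
      unfolding set_mult_def using that subgroup.one_closed[OF assms(1)] by blast
  qed
  ultimately show "H \<subseteq> H <#> K" "K \<subseteq> H <#> K" by blast+
qed

lemma has_oliver_series_trivial: "has_oliver_series p G {\<one>}"
  unfolding has_oliver_series_def
  by (rule exI[of _ 0], rule exI[of _ "\<lambda>_. {\<one>}"]) (simp add: one_is_normal)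

lemma has_oliver_series_step:
  assumes "has_oliver_series p G X" "Y \<lhd> G" "X \<subseteq> Y"
    and comm: "iterated_commutator G (Omega1 p G (centralizer G X)) Y (p - 1) = {\<one>}"
  shows "has_oliver_series p G Y"
proof (cases "X = Y")
  case True
  with assms(1) show ?thesis by simp
next
  case False
  from assms(1) obtain n Q where Q: "Q 0 = {\<one>}" "Q n = X" "\<forall>i\<le>n. Q i \<lhd> G"
    "\<forall>i<n. Q i \<subset> Q (Suc i) \<and>
       iterated_commutator G (Omega1 p G (centralizer G (Q i))) (Q (Suc i)) (p - 1) = {\<one>}"
    unfolding has_oliver_series_def by blast
  let ?Q = "Q(Suc n := Y)"
  have "?Q 0 = {\<one>} \<and> ?Q (Suc n) = Y \<and> (\<forall>i\<le>Suc n. ?Q i \<lhd> G) \<and>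
        (\<forall>i<Suc n. ?Q i \<subset> ?Q (Suc i) \<and>
          iterated_commutator G (Omega1 p G (centralizer G (?Q i))) (?Q (Suc i)) (p - 1) = {\<one>})"
    using Q assms(2,3) comm False by (auto simp: less_Suc_eq le_Suc_eq)
  then show ?thesis
    unfolding has_oliver_series_def by blast
qed

lemma iterated_commutator_mono:
  assumes "X \<subseteq> X'" "X' \<subseteq> carrier G" "Y \<subseteq> carrier G"
  shows "iterated_commutator G X Y n \<subseteq> iterated_commutator G X' Y n"
proof (induction n)
  case (Suc n)
  then show ?case
    unfolding iterated_commutator.simps commutator_subgroup_def
    by (intro mono_generate) blast
qed (use assms in simp)

lemma iterated_commutator_in_normal:
  assumes "C \<lhd> G" "X \<subseteq> C" "Y \<subseteq> carrier G"
  shows "iterated_commutator G X Y n \<subseteq> C"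
proof (induction n)
  case (Suc n)
  interpret C: normal C G by fact
  have "inv x \<otimes> inv y \<otimes> x \<otimes> y \<in> C" if "x \<in> C" "y \<in> carrier G" for x y
    using C.inv_op_closed1[OF that(2,1)] that C.m_closed[of "inv x" "inv y \<otimes> x \<otimes> y"]
    by (simp add: m_assoc)
  then show ?case
    using Suc assms(3) unfolding iterated_commutator.simps commutator_subgroup_def
    by (intro generate_subgroup_incl C.subgroup_axioms) auto
qed (use assms in simp)

lemma centralizer_normal:
  assumes "N \<lhd> G"
  shows "centralizer G N \<lhd> G"
proof -
  interpret N: normal N G by fact
  have sub: "subgroup (centralizer G N) G"
  proof (rule subgroupI)
    fix a assume a: "a \<in> centralizer G N"
    have "inv a \<otimes> h = h \<otimes> inv a" if "h \<in> N" for h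
    proof -
      have c: "a \<in> carrier G" "h \<in> carrier G" "a \<otimes> h = h \<otimes> a"
        using a that N.subset by (auto simp: centralizer_def)
      then have "inv a \<otimes> h = inv a \<otimes> ((h \<otimes> a) \<otimes> inv a)" by (simp add: m_assoc)
      also have "\<dots> = inv a \<otimes> ((a \<otimes> h) \<otimes> inv a)" using c by simp
      also have "\<dots> = (inv a \<otimes> a) \<otimes> (h \<otimes> inv a)" using c(1,2) by (simp only: m_assoc m_closed inv_closed)
      also have "\<dots> = h \<otimes> inv a" using c(1,2) by simp
      finally show ?thesis .
    qed
    then show "inv a \<in> centralizer G N"
      using a by (simp add: centralizer_def)
  next
    fix a b assume a: "a \<in> centralizer G N" and b: "b \<in> centralizer G N"
    have "a \<otimes> b \<otimes> h = h \<otimes> (a \<otimes> b)" if "h \<in> N" for h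
    proof -
      have c: "a \<in> carrier G" "b \<in> carrier G" "h \<in> carrier G"
          "a \<otimes> h = h \<otimes> a" "b \<otimes> h = h \<otimes> b"
        using a b that N.subset by (auto simp: centralizer_def)
      have "a \<otimes> b \<otimes> h = a \<otimes> (h \<otimes> b)" using c by (simp add: m_assoc)
      also have "\<dots> = (h \<otimes> a) \<otimes> b" using c by (simp add: m_assoc[symmetric])
      finally show ?thesis using c by (simp add: m_assoc)
    qed
    then show "a \<otimes> b \<in> centralizer G N"
      using a b by (simp add: centralizer_def)
  qed (use N.subset in \<open>auto simp: centralizer_def intro!: exI[of _ \<one>]\<close>)
  moreover have "x \<otimes> h \<otimes> inv x \<in> centralizer G N"
    if x: "x \<in> carrier G" and h: "h \<in> centralizer G N" for x h
  proof -
    have hc: "h \<in> carrier G" using h by (simp add: centralizer_def)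
    have "x \<otimes> h \<otimes> inv x \<otimes> k = k \<otimes> (x \<otimes> h \<otimes> inv x)" if k: "k \<in> N" for k
    proof -
      have kc: "k \<in> carrier G" using k N.subset by auto
      define k' where "k' = inv x \<otimes> k \<otimes> x"
      have k': "k' \<in> N" "k' \<in> carrier G"
        using N.inv_op_closed1[OF x k] N.subset by (auto simp: k'_def)
      have eq: "x \<otimes> a \<otimes> inv x \<otimes> (x \<otimes> b \<otimes> inv x) = x \<otimes> (a \<otimes> b) \<otimes> inv x"
        if "a \<in> carrier G" "b \<in> carrier G" for a b
        using x that by (simp add: m_assoc inv_mult_cancel mult_inv_cancel)
      have k_eq: "k = x \<otimes> k' \<otimes> inv x"
        using x kc by (simp add: k'_def m_assoc inv_mult_cancel mult_inv_cancel)
      have "h \<otimes> k' = k' \<otimes> h" using h k' by (simp add: centralizer_def)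
      then show ?thesis
        unfolding k_eq using eq[OF hc k'(2)] eq[OF k'(2) hc] by simp
    qed
    then show ?thesis using x hc by (simp add: centralizer_def)
  qed
  ultimately show ?thesis by (simp add: normal_inv_iff)
qed

lemma Omega1_subset:
  assumes "subgroup H G"
  shows "Omega1 p G H \<subseteq> H"
  unfolding Omega1_def using assms by (intro generate_subgroup_incl) auto

lemma iterated_commutator_mult_subset:
  assumes Q: "Q \<subseteq> carrier G" and R: "R \<subseteq> carrier G"
    and C: "C \<lhd> G" "C \<subseteq> centralizer G Q" and V: "V \<subseteq> C"
  shows "iterated_commutator G V (Q <#> R) n \<subseteq> iterated_commutator G V R n"
proof (induction n)
  case (Suc n)
  have "inv x \<otimes> inv y \<otimes> x \<otimes> y \<in>
          (\<Union>x\<in>iterated_commutator G V R n. \<Union>y\<in>R. {inv x \<otimes> inv y \<otimes> x \<otimes> y})"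
    if x: "x \<in> iterated_commutator G V (Q <#> R) n" and y: "y \<in> Q <#> R" for x y
  proof -
    from y obtain q r where qr: "q \<in> Q" "r \<in> R" "y = q \<otimes> r"
      unfolding set_mult_def by blast
    have xV: "x \<in> iterated_commutator G V R n" using x Suc by blast
    then have "x \<in> centralizer G Q"
      using iterated_commutator_in_normal[OF C(1) V R] C(2) by blast
    then have xc: "x \<in> carrier G" "x \<otimes> q = q \<otimes> x"
      using qr by (auto simp: centralizer_def)
    have c: "q \<in> carrier G" "r \<in> carrier G" using qr Q R by auto
    have "inv q \<otimes> (x \<otimes> (q \<otimes> r)) = inv q \<otimes> ((x \<otimes> q) \<otimes> r)"
      using c xc(1) by (simp add: m_assoc)
    also have "\<dots> = x \<otimes> r"
      unfolding xc(2) using c xc(1) by (simp add: m_assoc inv_mult_cancel mult_inv_cancel)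
    finally have "inv x \<otimes> inv y \<otimes> x \<otimes> y = inv x \<otimes> inv r \<otimes> x \<otimes> r"
      unfolding qr(3) using c xc(1) by (simp add: inv_mult_group m_assoc)
    then show ?thesis using xV qr(2) by blast
  qed
  then show ?case
    unfolding iterated_commutator.simps commutator_subgroup_def
    by (intro mono_generate) blast
qed simp

lemma has_oliver_series_mult:
  assumes X: "has_oliver_series p G X" and Y: "has_oliver_series p G Y"
  shows "has_oliver_series p G (X <#> Y)"
proof -
  from Y obtain n Q where Q: "Q 0 = {\<one>}" "Q n = Y" "\<forall>i\<le>n. Q i \<lhd> G"
    "\<forall>i<n. Q i \<subset> Q (Suc i) \<and>
       iterated_commutator G (Omega1 p G (centralizer G (Q i))) (Q (Suc i)) (p - 1) = {\<one>}"
    unfolding has_oliver_series_def by blast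
  interpret X: normal X G using X by (rule has_oliver_series_normal)
  have "has_oliver_series p G (X <#> Q i)" if "i \<le> n" for i
    using that
  proof (induction i)
    case 0
    have "X <#> {\<one>} = X" using X.subset by (auto simp: set_mult_def)
    then show ?case using X Q(1) by simp
  next
    case (Suc i)
    interpret Qi: normal "Q i" G using Q Suc by simp
    interpret Qs: normal "Q (Suc i)" G using Q Suc by simp
    let ?N = "X <#> Q i"
    let ?C = "centralizer G ?N"
    let ?V = "Omega1 p G ?C"
    let ?W = "Omega1 p G (centralizer G (Q i))"
    have IH: "has_oliver_series p G ?N" using Suc by simp
    have C: "?C \<lhd> G"
      using IH has_oliver_series_normal centralizer_normal by blast
    have V: "?V \<subseteq> ?C"
      using C by (intro Omega1_subset normal_imp_subgroup)
    have sub: "Q i \<subseteq> ?N"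
      by (rule set_mult_upper[OF X.subgroup_axioms Qi.subgroup_axioms])
    have sub': "X \<subseteq> ?N"
      by (rule set_mult_upper[OF X.subgroup_axioms Qi.subgroup_axioms])
    have VW: "?V \<subseteq> ?W"
      unfolding Omega1_def using sub by (intro mono_generate) (auto simp: centralizer_def)
    have W: "?W \<subseteq> carrier G"
      unfolding Omega1_def by (intro generate_incl) (auto simp: centralizer_def)
    have "iterated_commutator G ?V (X <#> Q (Suc i)) (p - 1)
            \<subseteq> iterated_commutator G ?V (Q (Suc i)) (p - 1)"
      using sub' by (intro iterated_commutator_mult_subset[OF X.subset Qs.subset C _ V])
        (auto simp: centralizer_def)
    also have "\<dots> \<subseteq> iterated_commutator G ?W (Q (Suc i)) (p - 1)"
      by (rule iterated_commutator_mono[OF VW W Qs.subset])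
    also have "\<dots> = {\<one>}" using Q(4) Suc by simp
    finally have le: "iterated_commutator G ?V (X <#> Q (Suc i)) (p - 1) \<subseteq> {\<one>}" .
    moreover have "\<one> \<in> iterated_commutator G ?V (X <#> Q (Suc i)) (p - 1)"
      by (cases "p - 1") (auto simp: Omega1_def commutator_subgroup_def intro: generate.one)
    ultimately have eq: "iterated_commutator G ?V (X <#> Q (Suc i)) (p - 1) = {\<one>}" by blast
    have "?N \<subseteq> X <#> Q (Suc i)"
      using Q(4) Suc.prems by (intro mono_set_mult) (auto simp: Suc_le_eq)
    moreover have "X <#> Q (Suc i) \<lhd> G"
    proof -
      have sg: "subgroup (X <#> Q (Suc i)) G"
        using mult_norm_subgroup[OF X.normal_axioms Qs.subgroup_axioms] .
      have "g \<otimes> h \<otimes> inv g \<in> X <#> Q (Suc i)"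
        if g: "g \<in> carrier G" and h: "h \<in> X <#> Q (Suc i)" for g h
      proof -
        from h obtain a b where ab: "a \<in> X" "b \<in> Q (Suc i)" "h = a \<otimes> b"
          unfolding set_mult_def by blast
        have c: "a \<in> carrier G" "b \<in> carrier G" using ab X.subset Qs.subset by auto
        have "g \<otimes> h \<otimes> inv g = (g \<otimes> a \<otimes> inv g) \<otimes> (g \<otimes> b \<otimes> inv g)"
          unfolding ab(3) using g c by (simp add: m_assoc inv_mult_cancel mult_inv_cancel)
        moreover have "g \<otimes> a \<otimes> inv g \<in> X" "g \<otimes> b \<otimes> inv g \<in> Q (Suc i)"
          using X.inv_op_closed2 Qs.inv_op_closed2 g ab by auto
        ultimately show ?thesis unfolding set_mult_def by blast
      qed
      with sg show ?thesis by (simp add: normal_inv_iff)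
    qed
    ultimately show ?case using has_oliver_series_step[OF IH _ _ eq] by blast
  qed
  then show ?thesis using Q(2) by blast
qed

lemma oliver_subgroup_greatest:
  assumes "finite (carrier G)"
  shows "has_oliver_series p G (oliver_subgroup p G)"
    and "has_oliver_series p G Y \<Longrightarrow> Y \<subseteq> oliver_subgroup p G"
proof -
  have fin: "finite {X. has_oliver_series p G X}"
  proof (rule finite_subset)
    show "{X. has_oliver_series p G X} \<subseteq> Pow (carrier G)"
      by (auto dest!: has_oliver_series_normal normal_imp_subgroup subgroup.subset)
  qed (use assms in simp)
  have "{X. has_oliver_series p G X} \<noteq> {}"
    using has_oliver_series_trivial[of p] by blast
  from finite_has_maximal[OF fin this] obtain X where X: "has_oliver_series p G X"
    and max: "\<And>Y. has_oliver_series p G Y \<Longrightarrow> X \<subseteq> Y \<Longrightarrow> X = Y"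
    by auto
  have great: "Y \<subseteq> X" if Y: "has_oliver_series p G Y" for Y
  proof -
    interpret X: normal X G using X by (rule has_oliver_series_normal)
    interpret Y: normal Y G using Y by (rule has_oliver_series_normal)
    have "X \<subseteq> X <#> Y" "Y \<subseteq> X <#> Y"
      by (rule set_mult_upper[OF X.subgroup_axioms Y.subgroup_axioms])+
    with max[OF has_oliver_series_mult[OF X Y]] show ?thesis by blast
  qed
  have "oliver_subgroup p G = X"
    unfolding oliver_subgroup_def using X great by (intro Greatest_equality) auto
  then show "has_oliver_series p G (oliver_subgroup p G)"
    and "has_oliver_series p G Y \<Longrightarrow> Y \<subseteq> oliver_subgroup p G"
    using X great by auto
qed

end

end

theory Submission
  imports Defs "HOL-Number_Theory.Residues"
begin

text \<open>Write \<open>X\<close> for the Oliver subgroup and \<open>V\<close> for the elements \<open>x\<close> of the centralizer of \<open>X\<close> with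
\<open>x\<^sup>p = 1\<close>. By maximality of \<open>X\<close>, no series for \<open>X\<close> can be prolonged by a further normal subgroup. First
this shows that the centralizer of \<open>X\<close> lies in \<open>X\<close>, whence \<open>V\<close> is elementary abelian, and that \<open>X\<close> is
exactly the kernel of the conjugation action on \<open>V\<close>. So \<open>G = S/X\<close> is a group of
automorphisms of \<open>V\<close>, written additively below. If some elementary abelian subgroup of maximal order is not
contained in \<open>X\<close>, then Thompson's and Timmesfeld's replacement argument
(\<open>quadratic_element_exists\<close>) gives a quadratic element, that is an \<open>a \<notin> X\<close> with \<open>(a - 1)\<^sup>2 = 0\<close> on \<open>V\<close>.
It remains to see that the bound on the class of \<open>G\<close> leaves no room for quadratic elements.

The key is a computation (\<open>quadratic_commutator\<close>): if \<open>a\<close> and \<open>b\<close> are quadratic and \<open>a\<close> commutes with its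
conjugate \<open>a\<^sup>b\<close>, then \<open>[a, b]\<close> is again quadratic. Choose a nontrivial quadratic \<open>a\<close> as deep as
possible in the lower central series of \<open>G\<close>. Then \<open>a\<close> commutes with every quadratic \<open>b\<close>, by downward
induction on the depth of \<open>[a, b]\<close>: as \<open>[a, a\<^sup>b] = [a, [a, b]]\<close> lies deeper, \<open>a\<close> and \<open>a\<^sup>b\<close> commute by
induction, so \<open>[a, b]\<close> is quadratic and deeper than \<open>a\<close>, hence trivial. In particular the conjugates of
\<open>a\<close> commute with each other.

Let \<open>c\<close> be the class of \<open>G\<close>. Some nontrivial commutator \<open>z = [a, g\<^sub>1, \<dots>, g\<^sub>m]\<close> with \<open>m \<le> c - 1\<close> is central
in \<open>G\<close>. It is a product of \<open>2\<^sup>m\<close> commuting quadratic elements, conjugates of \<open>a\<close> or of its inverse, so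
\<open>z - 1\<close> is nilpotent of index at most \<open>2\<^sup>m + 1 \<le> 2\<^bsup>c-1\<^esup> + 1 \<le> p - 1\<close>. Then \<open>X\<close> together with \<open>z\<close> generates
a larger normal subgroup that prolongs a series for \<open>X\<close>, a contradiction.\<close>

section \<open>Commutators and the lower central series\<close>

definition commutator :: "('a, 'b) monoid_scheme \<Rightarrow> 'a \<Rightarrow> 'a \<Rightarrow> 'a" where
  "commutator G x y = inv\<^bsub>G\<^esub> x \<otimes>\<^bsub>G\<^esub> inv\<^bsub>G\<^esub> y \<otimes>\<^bsub>G\<^esub> x \<otimes>\<^bsub>G\<^esub> y"

lemma (in group) commutator_closed [simp]:
  "x \<in> carrier G \<Longrightarrow> y \<in> carrier G \<Longrightarrow> commutator G x y \<in> carrier G"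
  by (simp add: commutator_def)

lemma (in group) mult_commutator:
  "x \<in> carrier G \<Longrightarrow> y \<in> carrier G \<Longrightarrow> x \<otimes> commutator G x y = inv y \<otimes> x \<otimes> y"
  by (simp add: commutator_def m_assoc mult_inv_cancel)

lemma (in normal) commutator_in_normal:
  assumes "x \<in> H" "y \<in> carrier G"
  shows "commutator G x y \<in> H"
  using inv_op_closed1[OF assms(2,1)] assms subgroup.m_closed[OF subgroup_axioms, of "inv x" "inv y \<otimes> x \<otimes> y"]
  by (simp add: commutator_def m_assoc)

lemma (in group) commutator_eq_one:
  "x \<in> carrier G \<Longrightarrow> y \<in> carrier G \<Longrightarrow> x \<otimes> y = y \<otimes> x \<Longrightarrow> commutator G x y = \<one>"
  by (simp add: commutator_def m_assoc) (simp add: inv_mult_cancel)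

lemma (in group) inv_commutator:
  "x \<in> carrier G \<Longrightarrow> y \<in> carrier G \<Longrightarrow> inv (commutator G x y) = commutator G y x"
  by (simp add: commutator_def inv_mult_group m_assoc)

lemma (in normal) commutator_in_normal':
  assumes "x \<in> carrier G" "y \<in> H"
  shows "commutator G x y \<in> H"
  using subgroup.m_inv_closed[OF subgroup_axioms commutator_in_normal[OF assms(2,1)]] assms subset
  by (auto simp: inv_commutator)

lemma (in group) lower_central_series_subgroup: "subgroup (lower_central_series G j) G"
proof (induction j)
  case 0
  then show ?case by (simp add: lower_central_series_def subgroup_self)
next
  case (Suc j)
  then show ?case
    unfolding lower_central_series_def iterated_commutator.simps commutator_subgroup_def
    by (intro generate_is_subgroup) (auto dest: subgroup.mem_carrier)
qed

lemma (in group) commutator_in_lower_central_series: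
  "x \<in> lower_central_series G j \<Longrightarrow> y \<in> carrier G \<Longrightarrow>
    commutator G x y \<in> lower_central_series G (Suc j)"
  by (auto simp: lower_central_series_def commutator_subgroup_def commutator_def intro!: generate.incl)

section \<open>Nilpotent quotients\<close>

text \<open>This is nilpotency of class at most \<open>c\<close> of the quotient by \<open>X\<close>, expressed without cosets: \<open>L j\<close> plays the
part of the full preimage in \<open>G\<close> of the \<open>j\<close>-th entry of the lower central series, counted from \<open>0\<close>.\<close>
locale nilpotent_quotient = normal X G for X and G (structure) +
  fixes L :: "nat \<Rightarrow> 'a set" and c :: nat
  assumes L_0: "carrier G \<subseteq> L 0"
    and L_inv: "x \<in> L j \<Longrightarrow> inv x \<in> L j"
    and L_commutator: "x \<in> L j \<Longrightarrow> s \<in> carrier G \<Longrightarrow> commutator G x s \<in> L (Suc j)"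
    and L_c: "L c \<subseteq> X"
begin

text \<open>Forming commutators with arbitrary elements leads into \<open>X\<close> after at most \<open>c\<close> steps, and the last element
outside \<open>X\<close> is central modulo \<open>X\<close>. The predicate \<open>P\<close> records what survives after \<open>m\<close> steps.\<close>
lemma descent:
  assumes "x \<in> carrier G" "x \<notin> X" "P 0 x"
    and P: "\<And>j y s. y \<in> carrier G \<Longrightarrow> s \<in> carrier G \<Longrightarrow> P j y \<Longrightarrow> P (Suc j) (commutator G y s)"
  shows "\<exists>m<c. \<exists>z\<in>carrier G. z \<notin> X \<and> P m z \<and> (\<forall>s\<in>carrier G. commutator G z s \<in> X)"
proof (rule ccontr)
  assume contr: "\<not> ?thesis"
  have "j \<le> c \<Longrightarrow> \<exists>z\<in>carrier G. z \<notin> X \<and> P j z \<and> z \<in> L j" for j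
  proof (induction j)
    case 0
    then show ?case using assms L_0 by blast
  next
    case (Suc j)
    then obtain z where z: "z \<in> carrier G" "z \<notin> X" "P j z" "z \<in> L j" by auto
    have "\<exists>s\<in>carrier G. commutator G z s \<notin> X"
    proof (rule ccontr)
      assume "\<not> ?thesis"
      then have "\<exists>z\<in>carrier G. z \<notin> X \<and> P j z \<and> (\<forall>s\<in>carrier G. commutator G z s \<in> X)"
        using z by blast
      moreover have "j < c" using Suc.prems by simp
      ultimately show False using contr by blast
    qed
    then obtain s where "s \<in> carrier G" "commutator G z s \<notin> X" by blast
    then show ?case using z P L_commutator by (metis commutator_closed)
  qed
  from this[of c] show False using L_c by auto
qed

end

lemma (in group) factor_group_nilpotent_quotient:
  assumes "X \<lhd> G" and nil: "nilpotent_of_class (G Mod X) c"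
  shows "nilpotent_quotient X G
    (\<lambda>j. {x \<in> carrier G. X #> x \<in> lower_central_series (G Mod X) j}) c"
proof -
  interpret X: normal X G by fact
  interpret F: group "G Mod X" by (rule X.factorgroup_is_group)
  have coset: "X #> x \<in> carrier (G Mod X)" if "x \<in> carrier G" for x
    using that by (simp add: carrier_FactGroup)
  have inv_coset: "inv\<^bsub>G Mod X\<^esub> (X #> x) = X #> inv x" if "x \<in> carrier G" for x
    using that by (simp add: X.inv_FactGroup coset X.rcos_inv)
  have comm_coset: "X #> commutator G x y = commutator (G Mod X) (X #> x) (X #> y)"
    if "x \<in> carrier G" "y \<in> carrier G" for x y
    using that by (simp add: commutator_def inv_coset X.rcos_sum)
  show ?thesis
  proof unfold_locales
    fix x j s assume "x \<in> {x \<in> carrier G. X #> x \<in> lower_central_series (G Mod X) j}"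
      and s: "s \<in> carrier G"
    then have "x \<in> carrier G" "X #> x \<in> lower_central_series (G Mod X) j" by auto
    then show "commutator G x s \<in> {x \<in> carrier G. X #> x \<in> lower_central_series (G Mod X) (Suc j)}"
      using s F.commutator_in_lower_central_series[OF _ coset[OF s]] by (simp add: comm_coset)
  next
    show "{x \<in> carrier G. X #> x \<in> lower_central_series (G Mod X) c} \<subseteq> X"
      using nil coset_join1[OF _ _ X.subgroup_axioms] by (auto simp: nilpotent_of_class_def)
  next
    fix x j assume "x \<in> {x \<in> carrier G. X #> x \<in> lower_central_series (G Mod X) j}"
    then show "inv x \<in> {x \<in> carrier G. X #> x \<in> lower_central_series (G Mod X) j}"
      using subgroup.m_inv_closed[OF F.lower_central_series_subgroup] by (auto simp flip: inv_coset)
  qed (auto simp: lower_central_series_def coset)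
qed

section \<open>Conjugation on an abelian normal subgroup\<close>

locale abelian_normal_subgroup = normal V G for V and G (structure) +
  assumes V_comm: "v \<in> V \<Longrightarrow> w \<in> V \<Longrightarrow> v \<otimes> w = w \<otimes> v"
begin

definition act :: "'a \<Rightarrow> 'a \<Rightarrow> 'a" where
  "act s v = inv s \<otimes> v \<otimes> s"

text \<open>In additive language this is the endomorphism \<open>s - 1\<close> of \<open>V\<close>; its value at \<open>v\<close> is the commutator \<open>[v, s]\<close>.\<close>
definition diff :: "'a \<Rightarrow> 'a \<Rightarrow> 'a" where
  "diff s v = inv v \<otimes> act s v"

definition quadratic :: "'a \<Rightarrow> bool" where
  "quadratic s \<longleftrightarrow> s \<in> carrier G \<and> (\<forall>v\<in>V. diff s (diff s v) = \<one>)"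

lemma V_carrier [simp]: "v \<in> V \<Longrightarrow> v \<in> carrier G"
  using subset by blast

lemma V_mult [simp]: "v \<in> V \<Longrightarrow> w \<in> V \<Longrightarrow> v \<otimes> w \<in> V"
  by (rule subgroup.m_closed[OF subgroup_axioms])

lemma V_one [simp]: "\<one> \<in> V"
  by (rule subgroup.one_closed[OF subgroup_axioms])

lemma V_inv [simp]: "v \<in> V \<Longrightarrow> inv v \<in> V"
  by (rule subgroup.m_inv_closed[OF subgroup_axioms])

lemma V_lcomm: "u \<in> V \<Longrightarrow> v \<in> V \<Longrightarrow> w \<in> V \<Longrightarrow> u \<otimes> (v \<otimes> w) = v \<otimes> (u \<otimes> w)"
  by (metis V_carrier V_comm m_assoc)

lemma V_cancel:
  assumes "u \<in> V" "v \<in> V"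
  shows "u \<otimes> (v \<otimes> inv u) = v" and "w \<in> V \<Longrightarrow> u \<otimes> (v \<otimes> (inv u \<otimes> w)) = v \<otimes> w"
  using assms by (simp_all add: V_lcomm[of u v] mult_inv_cancel)

lemma V_inv_mult: "v \<in> V \<Longrightarrow> w \<in> V \<Longrightarrow> inv (v \<otimes> w) = inv v \<otimes> inv w"
  by (simp add: inv_mult_group V_comm)

lemmas V_simps = m_assoc V_comm V_lcomm V_inv_mult mult_inv_cancel inv_mult_cancel

lemma act_in_V [simp]: "s \<in> carrier G \<Longrightarrow> v \<in> V \<Longrightarrow> act s v \<in> V"
  by (simp add: act_def inv_op_closed1)

lemma diff_in_V [simp]: "s \<in> carrier G \<Longrightarrow> v \<in> V \<Longrightarrow> diff s v \<in> V"
  by (simp add: diff_def)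

lemma diff_eq_commutator: "s \<in> carrier G \<Longrightarrow> v \<in> V \<Longrightarrow> diff s v = commutator G v s"
  by (simp add: diff_def act_def commutator_def m_assoc)

lemma act_eq: "s \<in> carrier G \<Longrightarrow> v \<in> V \<Longrightarrow> act s v = v \<otimes> diff s v"
  by (simp add: diff_def mult_inv_cancel)

lemma diff_eq_one_iff: "s \<in> carrier G \<Longrightarrow> v \<in> V \<Longrightarrow> diff s v = \<one> \<longleftrightarrow> act s v = v"
  by (metis V_carrier act_in_V diff_def diff_in_V inv_mult_cancel l_inv mult_inv_cancel r_one act_eq)

lemma act_product: "s \<in> carrier G \<Longrightarrow> t \<in> carrier G \<Longrightarrow> v \<in> V \<Longrightarrow> act (s \<otimes> t) v = act t (act s v)"
  by (simp add: act_def inv_mult_group m_assoc)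

lemma act_one [simp]: "v \<in> V \<Longrightarrow> act \<one> v = v"
  by (simp add: act_def)

lemma act_mult: "s \<in> carrier G \<Longrightarrow> v \<in> V \<Longrightarrow> w \<in> V \<Longrightarrow> act s (v \<otimes> w) = act s v \<otimes> act s w"
  by (simp add: act_def m_assoc mult_inv_cancel)

lemma act_fixes_one [simp]: "s \<in> carrier G \<Longrightarrow> act s \<one> = \<one>"
  by (simp add: act_def)

lemma act_inverse: "s \<in> carrier G \<Longrightarrow> v \<in> V \<Longrightarrow> act s (inv v) = inv (act s v)"
  by (simp add: act_def inv_mult_group m_assoc)

lemma act_inv_act [simp]:
  "s \<in> carrier G \<Longrightarrow> v \<in> V \<Longrightarrow> act (inv s) (act s v) = v"
  "s \<in> carrier G \<Longrightarrow> v \<in> V \<Longrightarrow> act s (act (inv s) v) = v"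
  by (simp_all flip: act_product)

lemma diff_mult: "s \<in> carrier G \<Longrightarrow> v \<in> V \<Longrightarrow> w \<in> V \<Longrightarrow> diff s (v \<otimes> w) = diff s v \<otimes> diff s w"
  by (simp add: diff_def act_mult V_simps)

lemma diff_one [simp]: "s \<in> carrier G \<Longrightarrow> diff s \<one> = \<one>"
  by (simp add: diff_def)

lemma diff_inverse: "s \<in> carrier G \<Longrightarrow> v \<in> V \<Longrightarrow> diff s (inv v) = inv (diff s v)"
  by (simp add: diff_def act_inverse V_inv_mult)

lemma quadraticD: "quadratic s \<Longrightarrow> s \<in> carrier G" "quadratic s \<Longrightarrow> v \<in> V \<Longrightarrow> diff s (diff s v) = \<one>"
  by (auto simp: quadratic_def)

lemma quadratic_act_inv:
  assumes "quadratic s" "v \<in> V"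
  shows "act (inv s) v = v \<otimes> inv (diff s v)"
proof -
  have s: "s \<in> carrier G" using assms quadraticD by blast
  have "act s (v \<otimes> inv (diff s v)) = v"
    using assms s by (simp add: act_eq diff_mult diff_inverse quadraticD V_simps)
  then show ?thesis using act_inv_act(1)[OF s, of "v \<otimes> inv (diff s v)"] s assms by simp
qed

lemma diff_conjugate:
  assumes "s \<in> carrier G" "g \<in> carrier G" "v \<in> V"
  shows "diff (inv g \<otimes> s \<otimes> g) v = act g (diff s (act (inv g) v))"
  using assms by (simp add: diff_def act_product act_mult act_inverse)

lemma quadratic_conjugate:
  assumes "quadratic s" "g \<in> carrier G"
  shows "quadratic (inv g \<otimes> s \<otimes> g)"
  using assms by (simp add: quadratic_def diff_conjugate)

lemma diff_commute:
  assumes "s \<in> carrier G" "v \<in> V" "\<And>u. u \<in> V \<Longrightarrow> act t (act s u) = act s (act t u)" "t \<in> carrier G"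
  shows "act t (diff s v) = diff s (act t v)"
  using assms by (simp add: diff_def act_mult act_inverse)

lemma diff_funpow_in_V [simp]: "s \<in> carrier G \<Longrightarrow> v \<in> V \<Longrightarrow> (diff s ^^ r) v \<in> V"
  by (induction r) auto

lemma diff_funpow_one [simp]: "s \<in> carrier G \<Longrightarrow> (diff s ^^ r) \<one> = \<one>"
  by (induction r) auto

lemma diff_funpow_mult:
  "s \<in> carrier G \<Longrightarrow> v \<in> V \<Longrightarrow> w \<in> V \<Longrightarrow> (diff s ^^ r) (v \<otimes> w) = (diff s ^^ r) v \<otimes> (diff s ^^ r) w"
  by (induction r) (auto simp: diff_mult)

lemma diff_funpow_inverse:
  "s \<in> carrier G \<Longrightarrow> v \<in> V \<Longrightarrow> (diff s ^^ r) (inv v) = inv ((diff s ^^ r) v)"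
  by (induction r) (auto simp: diff_inverse)

lemma diff_funpow_commute:
  assumes "s \<in> carrier G" "v \<in> V" "\<And>u. u \<in> V \<Longrightarrow> act t (act s u) = act s (act t u)" "t \<in> carrier G"
  shows "act t ((diff s ^^ r) v) = (diff s ^^ r) (act t v)"
  using assms(1,2) by (induction r) (auto simp: diff_commute assms)

text \<open>With \<open>t\<close> the inverse of \<open>s\<close> we have \<open>t - 1 = - t (s - 1)\<close>, which differs from \<open>s - 1\<close> by an
automorphism commuting with it.\<close>
lemma diff_inv_funpow_eq_one:
  assumes "s \<in> carrier G" "v \<in> V" "(diff s ^^ r) v = \<one>"
  shows "(diff (inv s) ^^ r) v = \<one>"
  using assms(2,3)
proof (induction r arbitrary: v)
  case (Suc r)
  have "diff (inv s) v = inv (act (inv s) (diff s v))"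
    using assms(1) Suc.prems by (simp add: diff_def act_mult act_inverse V_simps)
  moreover have "(diff s ^^ r) (inv (act (inv s) (diff s v))) = \<one>"
    using assms(1) Suc.prems
    by (simp add: diff_funpow_inverse funpow_swap1 flip: diff_funpow_commute)
  ultimately show ?case
    using Suc.IH[of "diff (inv s) v"] assms(1) Suc.prems by (simp add: funpow_swap1)
qed auto

lemma diff_conjugate_funpow:
  assumes "s \<in> carrier G" "g \<in> carrier G" "v \<in> V"
  shows "(diff (inv g \<otimes> s \<otimes> g) ^^ r) v = act g ((diff s ^^ r) (act (inv g) v))"
  using assms by (induction r) (simp_all add: diff_conjugate)

text \<open>The identity \<open>xy - 1 = (x - 1) y + (y - 1)\<close> splits a vector into one on which \<open>x - 1\<close> and one on which
\<open>y - 1\<close> is nilpotent of smaller index; since everything commutes, the indices less one add up, as in the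
binomial theorem.\<close>
lemma diff_product_funpow_eq_one:
  assumes "x \<in> carrier G" "y \<in> carrier G"
    and xy: "\<And>u. u \<in> V \<Longrightarrow> act x (act y u) = act y (act x u)"
    and "v \<in> V" "(diff x ^^ r) v = \<one>" "(diff y ^^ q) v = \<one>"
  shows "(diff (x \<otimes> y) ^^ (r + q - 1)) v = \<one>"
  using assms(4-)
proof (induction "r + q" arbitrary: r q v)
  case 0
  then show ?case by simp
next
  case (Suc n)
  note [simp] = assms(1,2)
  show ?case
  proof (cases "r = 0 \<or> q = 0")
    case True
    then show ?thesis using Suc.prems by auto
  next
    case False
    then obtain r' q' where rq: "r = Suc r'" "q = Suc q'" by (meson not0_implies_Suc)
    \<comment> \<open>the two summands of \<open>v (xy - 1)\<close>: \<open>v (x - 1) y\<close> and \<open>v (y - 1)\<close>\<close>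
    define w1 w2 where "w1 = act y (diff x v)" and "w2 = diff y v"
    have [simp]: "w1 \<in> V" "w2 \<in> V" using Suc.prems by (simp_all add: w1_def w2_def)
    have c1: "act x (diff y u) = diff y (act x u)" "act y (diff x u) = diff x (act y u)" if "u \<in> V" for u
      using that by (simp_all add: diff_commute xy)
    have c2: "diff x (diff y u) = diff y (diff x u)" if "u \<in> V" for u
      using that by (simp add: diff_def[of x] diff_def[of x "diff y u"] c1 diff_mult diff_inverse)
    have c3: "(diff x ^^ k) (diff y u) = diff y ((diff x ^^ k) u)" if "u \<in> V" for k u
      using that by (induction k) (auto simp: c2)
    have c4: "(diff y ^^ k) (diff x u) = diff x ((diff y ^^ k) u)" if "u \<in> V" for k u
      using that by (induction k) (auto simp: c2)
    have "(diff x ^^ r') w1 = \<one>"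
      using Suc.prems rq by (simp add: w1_def funpow_swap1 xy flip: diff_funpow_commute)
    moreover have "(diff y ^^ q) w1 = \<one>"
      using Suc.prems rq(1) by (simp add: w1_def c4 flip: diff_funpow_commute)
    ultimately have "(diff (x \<otimes> y) ^^ (r' + q - 1)) w1 = \<one>"
      using Suc.hyps(1)[of r' q w1] Suc.hyps(2) rq by simp
    moreover have "(diff x ^^ r) w2 = \<one>"
      using Suc.prems by (simp add: w2_def c3)
    moreover have "(diff y ^^ q') w2 = \<one>"
      using Suc.prems rq by (simp add: w2_def funpow_swap1)
    ultimately have "(diff (x \<otimes> y) ^^ (r' + q')) (w1 \<otimes> w2) = \<one>"
      using Suc.hyps(1)[of r q' w2] Suc.hyps(2) rq by (simp add: diff_funpow_mult)
    moreover have "diff (x \<otimes> y) v = w1 \<otimes> w2"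
      using Suc.prems by (simp add: w1_def w2_def diff_def act_product act_mult act_inverse V_simps)
    ultimately show ?thesis using rq by (simp add: funpow_swap1)
  qed
qed

definition fixator :: "'a set \<Rightarrow> 'a set" where
  "fixator Y = {s \<in> carrier G. \<forall>v\<in>Y. act s v = v}"

definition fixed_points :: "'a set \<Rightarrow> 'a set" where
  "fixed_points F = {v \<in> V. \<forall>f\<in>F. act f v = v}"

lemma fixator_subgroup:
  assumes "Y \<subseteq> V"
  shows "subgroup (fixator Y) G"
proof (rule subgroupI)
  show "fixator Y \<noteq> {}"
    using assms by (auto simp: fixator_def intro!: exI[of _ \<one>])
  show "inv a \<in> fixator Y" if "a \<in> fixator Y" for a
  proof -
    have "act (inv a) v = v" if v: "v \<in> Y" for v
    proof -
      have "a \<in> carrier G" "v \<in> V" "act a v = v"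
        using \<open>a \<in> fixator Y\<close> v assms by (auto simp: fixator_def)
      then show ?thesis by (metis act_inv_act(1))
    qed
    then show ?thesis using that by (simp add: fixator_def)
  qed
  show "a \<otimes> b \<in> fixator Y" if "a \<in> fixator Y" "b \<in> fixator Y" for a b
    using that assms by (auto simp: fixator_def act_product subset_iff)
qed (auto simp: fixator_def)

lemma fixator_eq_centralizer: "fixator V = centralizer G V"
proof -
  have "(act s v = v) = (s \<otimes> v = v \<otimes> s)" if "s \<in> carrier G" "v \<in> V" for s v
  proof
    assume "act s v = v"
    then have "s \<otimes> v = s \<otimes> act s v" by simp
    also have "\<dots> = v \<otimes> s" using that by (simp add: act_def m_assoc mult_inv_cancel)
    finally show "s \<otimes> v = v \<otimes> s" .
  next
    assume "s \<otimes> v = v \<otimes> s"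
    then have "act s v = inv s \<otimes> (s \<otimes> v)" using that by (simp add: act_def m_assoc)
    then show "act s v = v" using that by (simp add: inv_mult_cancel)
  qed
  then have "(\<forall>v\<in>V. act s v = v) = (\<forall>v\<in>V. s \<otimes> v = v \<otimes> s)" if "s \<in> carrier G" for s
    using that by (intro ball_cong) auto
  then show ?thesis unfolding fixator_def centralizer_def by blast
qed

end

section \<open>Commutators of quadratic elements\<close>

context abelian_normal_subgroup
begin

text \<open>Let \<open>\<alpha> = a - 1\<close> and \<open>\<nu> = b - 1\<close>, operators with square zero. Conjugation by \<open>b = 1 + \<nu>\<close> turns \<open>\<alpha>\<close> into
\<open>\<alpha> + \<alpha>\<nu> - \<nu>\<alpha> - \<nu>\<alpha>\<nu>\<close>. That this commutes with \<open>\<alpha>\<close> means \<open>2\<alpha>\<nu>\<alpha> = \<nu>\<alpha>\<nu>\<alpha> - \<alpha>\<nu>\<alpha>\<nu>\<close>. Multiplying by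
\<open>\<alpha>\<close> and \<open>\<nu>\<close> on the two sides and cancelling \<open>2\<close> kills all these words one after another, until
\<open>\<alpha>\<nu>\<alpha> = 0\<close>. Then \<open>[a, b] - 1 = \<alpha>\<nu> - \<nu>\<alpha> - \<nu>\<alpha>\<nu>\<close>, and each term of its square contains
\<open>\<alpha>\<nu>\<alpha>\<close>, \<open>\<alpha>\<alpha>\<close> or \<open>\<nu>\<nu>\<close>. These operators act from the right, so in the proof, with
\<open>A v = v\<alpha>\<close> and \<open>N v = v\<nu>\<close>, the word \<open>\<alpha>\<nu>\<close> becomes \<open>N (A v)\<close>.\<close>
lemma quadratic_commutator:
  assumes no_2_torsion: "\<And>v. v \<in> V \<Longrightarrow> v \<otimes> v = \<one> \<Longrightarrow> v = \<one>"
    and a: "quadratic a" and b: "quadratic b"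
    and commute: "\<And>v. v \<in> V \<Longrightarrow> act (inv b \<otimes> a \<otimes> b) (act a v) = act a (act (inv b \<otimes> a \<otimes> b) v)"
  shows "quadratic (commutator G a b)"
proof -
  have [simp]: "a \<in> carrier G" "b \<in> carrier G" using a b quadraticD by blast+
  define A N where "A = diff a" and "N = diff b"
  have [simp]: "A v \<in> V" "N v \<in> V" "A (A v) = \<one>" "N (N v) = \<one>" if "v \<in> V" for v
    using that a b by (simp_all add: A_def N_def quadraticD)
  have [simp]: "A \<one> = \<one>" "N \<one> = \<one>" by (simp_all add: A_def N_def)
  have hom: "A (v \<otimes> w) = A v \<otimes> A w" "N (v \<otimes> w) = N v \<otimes> N w" if "v \<in> V" "w \<in> V" for v w
    using that by (simp_all add: A_def N_def diff_mult)
  have hominv: "A (inv v) = inv (A v)" "N (inv v) = inv (N v)" if "v \<in> V" for v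
    using that by (simp_all add: A_def N_def diff_inverse)
  have acta: "act a v = v \<otimes> A v" and actb: "act b v = v \<otimes> N v" if "v \<in> V" for v
    using that by (simp_all add: A_def N_def act_eq)
  define f where "f v = act (inv b \<otimes> a \<otimes> b) v" for v
  have fV [simp]: "f v \<in> V" if "v \<in> V" for v using that by (simp add: f_def)
  have f: "f v = v \<otimes> (A v \<otimes> (N (A v) \<otimes> (inv (A (N v)) \<otimes> inv (N (A (N v))))))" if "v \<in> V" for v
    using that b
    by (simp add: f_def act_product quadratic_act_inv acta actb hom hominv flip: N_def)
      (simp add: V_simps V_cancel)
  have fA: "f (A v) = A v \<otimes> (inv (A (N (A v))) \<otimes> inv (N (A (N (A v)))))" if "v \<in> V" for v
    using that by (simp add: f)
  have Af: "A (f v) = A v \<otimes> (A (N (A v)) \<otimes> inv (A (N (A (N v)))))" if "v \<in> V" for v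
    using that by (simp add: f hom hominv)
  have fAf: "f (A v) = A (f v)" if "v \<in> V" for v
  proof -
    have "f v \<otimes> f (A v) = f v \<otimes> A (f v)"
      using commute[OF that] that by (simp add: acta flip: f_def) (simp add: f_def act_mult)
    then show ?thesis using that by simp
  qed
  \<comment> \<open>\<open>2\<alpha>\<nu>\<alpha> + \<alpha>\<nu>\<alpha>\<nu> = \<nu>\<alpha>\<nu>\<alpha>\<close>; all later identities come from it by multiplication\<close>
  have E: "A (N (A v)) \<otimes> (A (N (A v)) \<otimes> N (A (N (A v)))) = A (N (A (N v)))" if v: "v \<in> V" for v
  proof -
    let ?P = "A (N (A v))" and ?Q = "N (A (N (A v)))" and ?R = "A (N (A (N v)))"
    have "inv ?P \<otimes> inv ?Q = ?P \<otimes> inv ?R"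
      using fAf[OF v] v by (simp add: fA Af)
    then have "?P \<otimes> (?P \<otimes> inv ?R) \<otimes> (?R \<otimes> ?Q) = ?P \<otimes> (inv ?P \<otimes> inv ?Q) \<otimes> (?Q \<otimes> ?R)"
      using v V_comm[of ?R ?Q] by simp
    then show ?thesis
      using v by (simp add: m_assoc inv_mult_cancel mult_inv_cancel)
  qed
  have NANA_square: "N (A (N (A v))) \<otimes> N (A (N (A v))) = N (A (N (A (N v))))" if v: "v \<in> V" for v
    using arg_cong[OF E[OF v], of N] v by (simp add: hom)
  have NANAN: "N (A (N (A (N v)))) = \<one>" if v: "v \<in> V" for v
    by (rule no_2_torsion) (use v NANA_square[of "N v"] in auto)
  have NANA: "N (A (N (A v))) = \<one>" if v: "v \<in> V" for v
    by (rule no_2_torsion) (use v NANA_square[OF v] NANAN[OF v] in auto)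
  have ANAN: "A (N (A (N v))) = \<one>" if v: "v \<in> V" for v
    by (rule no_2_torsion) (use v E[of "N v"] NANAN[OF v] in auto)
  have ANA: "A (N (A v)) = \<one>" if v: "v \<in> V" for v
    by (rule no_2_torsion) (use v E[OF v] NANA ANAN in auto)
  have diff_comm: "diff (commutator G a b) v = N (A v) \<otimes> (inv (A (N v)) \<otimes> inv (N (A (N v))))"
    if v: "v \<in> V" for v
  proof -
    have "act (commutator G a b) v = f (act (inv a) v)"
      using v by (simp add: commutator_def f_def m_assoc flip: act_product)
    also have "\<dots> = f (v \<otimes> inv (A v))" using a v by (simp add: quadratic_act_inv A_def)
    also have "\<dots> = v \<otimes> (N (A v) \<otimes> (inv (A (N v)) \<otimes> inv (N (A (N v)))))"
      using v by (simp add: f hom hominv ANA NANA)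
        (simp add: m_assoc V_lcomm[of _ "inv (A v)"] mult_inv_cancel inv_mult_cancel)
    finally show ?thesis using v by (simp add: diff_def inv_mult_cancel)
  qed
  show ?thesis
    unfolding quadratic_def
    by (auto simp: diff_comm hom hominv ANA ANAN NANA)
qed

end

locale nilpotent_action = abelian_normal_subgroup V G + quot: nilpotent_quotient X G L c
  for V X L c and G (structure) +
  assumes kernel: "X = fixator V"
    and no_2_torsion: "v \<in> V \<Longrightarrow> v \<otimes> v = \<one> \<Longrightarrow> v = \<one>"
begin

lemma act_commute:
  assumes "s \<in> carrier G" "t \<in> carrier G" "commutator G s t \<in> X" "v \<in> V"
  shows "act s (act t v) = act t (act s v)"
proof -
  have "s \<otimes> t = t \<otimes> s \<otimes> commutator G s t"
    using assms(1,2) by (simp add: commutator_def m_assoc mult_inv_cancel)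
  then have "act (s \<otimes> t) v = act (t \<otimes> s \<otimes> commutator G s t) v" by simp
  also have "\<dots> = act (commutator G s t) (act s (act t v))"
    using assms by (simp add: act_product)
  also have "\<dots> = act s (act t v)"
  proof -
    have "act (commutator G s t) u = u" if "u \<in> V" for u
      using assms(3) that unfolding kernel fixator_def by blast
    then show ?thesis using assms by simp
  qed
  finally show ?thesis using assms by (simp add: act_product)
qed

text \<open>Downward induction on the depth \<open>c - d\<close> of \<open>e = [x, y]\<close>. As \<open>x\<^sup>y = x e\<close>, the commutator of \<open>x\<close> and
\<open>x\<^sup>y\<close> is \<open>[x, e]\<close>, one level deeper, so that \<open>x\<close> commutes with \<open>x\<^sup>y\<close> on \<open>V\<close>. Hence \<open>e\<close> is
quadratic; but it lies deeper than \<open>x\<close>, where all quadratic elements are trivial.\<close>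
lemma commutator_of_deepest_quadratic:
  assumes deepest: "\<And>s. quadratic s \<Longrightarrow> s \<in> L (Suc i) \<Longrightarrow> s \<in> X"
    and x: "quadratic x" "x \<in> L i" and y: "quadratic y"
  shows "commutator G x y \<in> X"
proof -
  have "commutator G x y \<in> X" if "quadratic y" "commutator G x y \<in> L (c - d)" for y d
    using that
  proof (induction d arbitrary: y)
    case 0
    then show ?case using quot.L_c by auto
  next
    case (Suc d)
    show ?case
    proof (cases "d < c")
      case False
      then show ?thesis using Suc by simp
    next
      case True
      have xy: "x \<in> carrier G" "y \<in> carrier G" using x Suc.prems quadraticD by blast+
      define e where "e = commutator G x y"
      have e: "e \<in> carrier G" using xy by (simp add: e_def)
      have conj: "inv y \<otimes> x \<otimes> y = x \<otimes> e" using xy by (simp add: e_def mult_commutator)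
      have "commutator G x (x \<otimes> e) = inv (commutator G e x)"
        using xy e by (simp add: commutator_def m_assoc inv_mult_group inv_mult_cancel mult_inv_cancel)
      moreover have "commutator G e x \<in> L (c - d)"
        using quot.L_commutator[of e "c - Suc d" x] Suc.prems True xy by (simp add: e_def Suc_diff_Suc)
      ultimately have "commutator G x (inv y \<otimes> x \<otimes> y) \<in> L (c - d)"
        using quot.L_inv conj by simp
      then have "commutator G x (inv y \<otimes> x \<otimes> y) \<in> X"
        using Suc.IH quadratic_conjugate x(1) xy(2) by blast
      then have "quadratic (commutator G x y)"
        using xy x(1) Suc.prems(1) act_commute[of x "inv y \<otimes> x \<otimes> y"]
        by (intro quadratic_commutator) (auto intro: no_2_torsion)
      then show ?thesis using deepest quot.L_commutator[OF x(2) xy(2)] by blast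
    qed
  qed
  moreover have "commutator G x y \<in> L 0"
    using quot.L_0 commutator_closed[OF quadraticD(1)[OF x(1)] quadraticD(1)[OF y]] by blast
  ultimately show ?thesis using y by (metis diff_self_eq_0)
qed

text \<open>A quadratic element outside \<open>X\<close> at maximal depth will do: if every depth \<open>j\<close> with such an element had one
at depth \<open>j + 1\<close> as well, there would be one in \<open>L c\<close>, which is contained in \<open>X\<close>.\<close>
lemma quadratic_commuting_exists:
  assumes "quadratic s" "s \<notin> X"
  shows "\<exists>a. quadratic a \<and> a \<notin> X \<and> (\<forall>y. quadratic y \<longrightarrow> commutator G a y \<in> X)"
proof (rule ccontr)
  assume contr: "\<not> ?thesis"
  have "\<exists>a. quadratic a \<and> a \<notin> X \<and> a \<in> L j" for j
  proof (induction j)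
    case 0
    have "s \<in> L 0" using quadraticD(1)[OF assms(1)] quot.L_0 by blast
    then show ?case using assms by blast
  next
    case (Suc j)
    then obtain a where a: "quadratic a" "a \<notin> X" "a \<in> L j" by blast
    with contr obtain y where "quadratic y" "commutator G a y \<notin> X" by blast
    then show ?case using commutator_of_deepest_quadratic[OF _ a(1,3), of y] by blast
  qed
  from this[of c] show False using quot.L_c by blast
qed

text \<open>Descend from an \<open>a\<close> whose conjugates all commute on \<open>V\<close>. Each step replaces \<open>y\<close> by the product of its
inverse and one of its conjugates, and this at most doubles the index of nilpotence less one, which
starts from \<open>1\<close>.\<close>
theorem central_element_of_small_nilpotence:
  assumes "quadratic s" "s \<notin> X"
  shows "\<exists>m<c. \<exists>z\<in>carrier G. z \<notin> X \<and> (\<forall>t\<in>carrier G. commutator G z t \<in> X) \<and>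
    (\<forall>v\<in>V. (diff z ^^ (2 ^ m + 1)) v = \<one>)"
proof -
  obtain a where a: "quadratic a" "a \<notin> X" "\<And>y. quadratic y \<Longrightarrow> commutator G a y \<in> X"
    using quadratic_commuting_exists[OF assms] by blast
  have ac [simp]: "a \<in> carrier G" by (rule quadraticD(1)[OF a(1)])
  define K where "K = {inv g \<otimes> a \<otimes> g | g. g \<in> carrier G}"
  define D where "D = generate G K"
  have K_sub: "K \<subseteq> carrier G" by (auto simp: K_def)
  have D_carrier [simp]: "x \<in> carrier G" if "x \<in> D" for x
    using that generate_incl[OF K_sub] by (auto simp: D_def)
  have "D \<lhd> G"
    unfolding D_def
  proof (rule normal_generateI[OF K_sub])
    fix h g assume "h \<in> K" "g \<in> carrier G"
    then obtain k where "k \<in> carrier G" "h = inv k \<otimes> a \<otimes> k" by (auto simp: K_def)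
    then have "g \<otimes> h \<otimes> inv g = inv (k \<otimes> inv g) \<otimes> a \<otimes> (k \<otimes> inv g)"
      using \<open>g \<in> carrier G\<close> by (simp add: inv_mult_group m_assoc)
    then show "g \<otimes> h \<otimes> inv g \<in> K"
      unfolding K_def using \<open>g \<in> carrier G\<close> \<open>k \<in> carrier G\<close> by blast
  qed
  then interpret D: normal D G .
  have aD: "a \<in> D"
    unfolding D_def K_def by (rule generate.incl) (auto intro!: exI[of _ \<one>])
  have K_comm: "act x (act y v) = act y (act x v)" if "x \<in> K" "y \<in> K" "v \<in> V" for x y v
  proof -
    from that obtain g h where gh: "g \<in> carrier G" "h \<in> carrier G"
      "x = inv g \<otimes> a \<otimes> g" "y = inv h \<otimes> a \<otimes> h" by (auto simp: K_def)
    \<comment> \<open>conjugating by the inverse of \<open>g\<close> reduces to the case \<open>x = a\<close>\<close>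
    define b where "b = inv (h \<otimes> inv g) \<otimes> a \<otimes> (h \<otimes> inv g)"
    have bc: "b \<in> carrier G" using gh by (simp add: b_def)
    have "quadratic b" unfolding b_def using gh by (intro quadratic_conjugate a(1)) simp
    then have b: "act a (act b u) = act b (act a u)" if "u \<in> V" for u
      using that act_commute[OF ac bc] a(3) by blast
    have y: "y = inv g \<otimes> b \<otimes> g"
      using gh by (simp add: b_def inv_mult_group m_assoc inv_mult_cancel)
    show ?thesis
      using gh(1,2) that(3) b bc unfolding gh(3) y by (simp add: act_product)
  qed
  define Comm where "Comm x = {s \<in> carrier G. \<forall>v\<in>V. act s (act x v) = act x (act s v)}" for x
  have Comm_sub: "subgroup (Comm x) G" if x: "x \<in> carrier G" for x
  proof (rule subgroupI)
    show "inv s \<in> Comm x" if s: "s \<in> Comm x" for s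
    proof -
      have "act (inv s) (act x v) = act x (act (inv s) v)" if v: "v \<in> V" for v
      proof -
        have "act (inv s) (act x v) = act (inv s) (act x (act s (act (inv s) v)))"
          using s v by (simp add: Comm_def)
        also have "\<dots> = act (inv s) (act s (act x (act (inv s) v)))"
          using s v x by (simp add: Comm_def)
        also have "\<dots> = act x (act (inv s) v)"
          by (rule act_inv_act(1)) (use s v x in \<open>auto simp: Comm_def\<close>)
        finally show ?thesis .
      qed
      then show ?thesis using s by (simp add: Comm_def)
    qed
  qed (use x in \<open>auto simp: Comm_def act_product intro!: exI[of _ \<one>]\<close>)
  have "D \<subseteq> Comm x" if "x \<in> K" for x
    unfolding D_def using that K_comm K_sub
    by (intro generate_subgroup_incl Comm_sub) (auto simp: Comm_def)
  then have "D \<subseteq> Comm x" if "x \<in> D" for x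
    unfolding D_def using that K_sub
    by (intro generate_subgroup_incl Comm_sub) (auto simp: Comm_def D_def[symmetric] subset_iff)
  then have D_comm: "act x (act y v) = act y (act x v)" if "x \<in> D" "y \<in> D" "v \<in> V" for x y v
    using that by (auto simp: Comm_def)
  define P where "P j x \<longleftrightarrow> x \<in> D \<and> (\<forall>v\<in>V. (diff x ^^ (2 ^ j + 1)) v = \<one>)" for j x
  have "\<exists>m<c. \<exists>z\<in>carrier G. z \<notin> X \<and> P m z \<and> (\<forall>t\<in>carrier G. commutator G z t \<in> X)"
  proof (rule quot.descent[OF ac a(2)])
    show "P 0 a" using aD a(1) by (simp add: P_def quadraticD)
  next
    fix j y t assume y: "y \<in> carrier G" "t \<in> carrier G" "P j y"
    define y' where "y' = inv t \<otimes> y \<otimes> t"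
    have D: "y \<in> D" "inv y \<in> D" "y' \<in> D"
      using y D.inv_op_closed1 by (auto simp: P_def y'_def D.m_inv_closed)
    have eq: "commutator G y t = inv y \<otimes> y'"
      using y by (simp add: commutator_def y'_def m_assoc)
    have "(diff (inv y \<otimes> y') ^^ (2 ^ j + 1 + (2 ^ j + 1) - 1)) v = \<one>" if v: "v \<in> V" for v
    proof (rule diff_product_funpow_eq_one[OF _ _ _ v])
      show "(diff (inv y) ^^ (2 ^ j + 1)) v = \<one>"
        using y v by (intro diff_inv_funpow_eq_one) (auto simp: P_def)
      show "(diff y' ^^ (2 ^ j + 1)) v = \<one>"
        unfolding y'_def diff_conjugate_funpow[OF y(1,2) v] using y v by (simp add: P_def)
    qed (use D D_comm in auto)
    then show "P (Suc j) (commutator G y t)"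
      using D by (auto simp: P_def eq mult_2)
  qed
  then show ?thesis by (auto simp: P_def)
qed

end

section \<open>Quadratic elements from large abelian subgroups\<close>

lemma card_le_fibre_bound:
  assumes "finite A" "finite B" "f ` A \<subseteq> B" "\<And>a. a \<in> A \<Longrightarrow> card {x \<in> A. f x = f a} \<le> k"
  shows "card A \<le> card B * k"
proof -
  have "card A \<le> card (\<Union>b\<in>f ` A. {x \<in> A. f x = b})"
    using assms(1) by (intro card_mono) auto
  also have "\<dots> \<le> (\<Sum>b\<in>f ` A. card {x \<in> A. f x = b})"
    using assms(1) by (intro card_UN_le) simp
  also have "\<dots> \<le> card (f ` A) * k"
    using sum_bounded_above[of "f ` A" "\<lambda>b. card {x \<in> A. f x = b}" k] assms(4) by auto
  also have "\<dots> \<le> card B * k"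
    by (rule mult_le_mono1[OF card_mono[OF assms(2,3)]])
  finally show ?thesis .
qed

lemma (in group) card_subgroup_product:
  assumes "finite (carrier G)" "subgroup H G" "subgroup K G"
  shows "card H * card K \<le> card (H <#> K) * card (H \<inter> K)"
proof -
  have HK: "H \<subseteq> carrier G" "K \<subseteq> carrier G" using assms subgroup.subset by auto
  have fin: "finite H" "finite K" using HK assms(1) finite_subset by blast+
  have "card (H \<times> K) \<le> card (H <#> K) * card (H \<inter> K)"
  proof (rule card_le_fibre_bound[of _ _ "\<lambda>(h, k). h \<otimes> k"])
    show "finite (H <#> K)"
      using set_mult_closed[OF HK] assms(1) finite_subset by blast
    fix a assume "a \<in> H \<times> K"
    then obtain h0 k0 where a: "a = (h0, k0)" "h0 \<in> H" "k0 \<in> K" by auto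
    let ?A = "{x \<in> H \<times> K. (case x of (h, k) \<Rightarrow> h \<otimes> k) = (case a of (h, k) \<Rightarrow> h \<otimes> k)}"
    let ?f = "\<lambda>(h, k). inv h0 \<otimes> h"
    have carr: "h0 \<in> carrier G" "k0 \<in> carrier G" using a HK by auto
    have "inj_on ?f ?A"
    proof (rule inj_onI)
      fix x y assume xy: "x \<in> ?A" "y \<in> ?A" "?f x = ?f y"
      obtain h k h' k' where xy': "x = (h, k)" "y = (h', k')" by fastforce
      have c: "h \<in> carrier G" "k \<in> carrier G" "h' \<in> carrier G" "k' \<in> carrier G"
        using xy(1,2) xy' HK by auto
      have "h = h'" using xy(3) xy' c carr by simp
      moreover have "h \<otimes> k = h' \<otimes> k'" using xy(1,2) xy' by simp
      ultimately show "x = y" using xy' c by simp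
    qed
    moreover have "?f ` ?A \<subseteq> H \<inter> K"
    proof
      fix y assume "y \<in> ?f ` ?A"
      then obtain h k where hk: "h \<in> H" "k \<in> K" "h \<otimes> k = h0 \<otimes> k0" "y = inv h0 \<otimes> h"
        using a(1) by auto
      have c: "h \<in> carrier G" "k \<in> carrier G" using hk HK by auto
      have "y = inv h0 \<otimes> (h \<otimes> k) \<otimes> inv k" using c carr hk(4) by (simp add: m_assoc)
      also have "\<dots> = k0 \<otimes> inv k" unfolding hk(3) using c carr by (simp add: inv_mult_cancel)
      finally have "y \<in> K" using a hk assms(3) by (simp add: subgroup.m_closed subgroup.m_inv_closed)
      moreover have "y \<in> H" using a hk assms(2) by (simp add: subgroup.m_closed subgroup.m_inv_closed)
      ultimately show "y \<in> H \<inter> K" by simp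
    qed
    ultimately show "card ?A \<le> card (H \<inter> K)"
      using fin by (intro card_inj_on_le) auto
  qed (use fin in \<open>auto simp: set_mult_def\<close>)
  then show ?thesis by (simp add: card_cartesian_product)
qed

context abelian_normal_subgroup
begin

text \<open>Take \<open>F\<close> minimal among the subgroups between the kernel \<open>K\<close> and \<open>E\<close>, other than \<open>K\<close>, that still satisfy
\<open>|K| |V| \<le> |F| |C\<^sub>V(F)|\<close>. For \<open>v \<in> V\<close> let \<open>[v, F]\<close> be the set of all
\<open>[v, f]\<close> with \<open>f \<in> F\<close>, let \<open>F\<^sub>v\<close> be the subgroup of \<open>F\<close> that fixes it pointwise, and let \<open>Y = [v, F] + C\<^sub>V(F)\<close>, a subset of \<open>C\<^sub>V(F\<^sub>v)\<close>. Because \<open>F\<close> is abelian, two elements of \<open>F\<close> have the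
same commutator with \<open>v\<close> modulo \<open>C\<^sub>V(F)\<close> only if they lie in the same coset of \<open>F\<^sub>v\<close>. Counting gives
\<open>|F| |C\<^sub>V(F)| \<le> |Y| |F\<^sub>v| \<le> |F\<^sub>v| |C\<^sub>V(F\<^sub>v)|\<close>, and so \<open>F\<^sub>v = F\<close> or \<open>F\<^sub>v = K\<close> by minimality. If
\<open>F\<^sub>v = F\<close> for all \<open>v\<close>, then \<open>F\<close> acts quadratically. If \<open>F\<^sub>v = K\<close>, then \<open>Y = V\<close> contains \<open>v\<close>, say
\<open>v = [v, f] + w\<close>; this makes \<open>u = [v, f]\<close> satisfy \<open>[u, f] = u\<close>, which forces \<open>u = 0\<close> since \<open>f\<close> acts
unipotently. So \<open>v\<close> is fixed by \<open>F\<close>, and \<open>F\<^sub>v = F\<close> after all.\<close>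
theorem quadratic_element_exists:
  fixes p :: nat
  assumes p: "prime p" "odd p" and fin: "finite (carrier G)"
    and V_exp: "\<And>v. v \<in> V \<Longrightarrow> v [^] p = \<one>"
    and E: "subgroup E G" "\<And>x y. x \<in> E \<Longrightarrow> y \<in> E \<Longrightarrow> x \<otimes> y = y \<otimes> x"
    and E_exp: "\<And>x. x \<in> E \<Longrightarrow> x [^] p = \<one>"
    and nontrivial: "\<not> E \<subseteq> fixator V"
    and large: "card (E \<inter> fixator V) * card V \<le> card E * card (fixed_points E)"
  shows "\<exists>e\<in>E. quadratic e \<and> e \<notin> fixator V"
proof -
  define K where "K = E \<inter> fixator V"
  define good where "good F \<longleftrightarrow> subgroup F G \<and> K \<subseteq> F \<and> F \<subseteq> E \<and> F \<noteq> K \<and>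
    card K * card V \<le> card F * card (fixed_points F)" for F
  have "good E" using E(1) nontrivial large by (auto simp: good_def K_def)
  define F where "F = arg_min card good"
  have F: "good F" and F_min: "\<And>H. good H \<Longrightarrow> card F \<le> card H"
    using arg_min_nat_lemma[of good E card, OF \<open>good E\<close>, folded F_def] by simp_all
  have F_sub: "subgroup F G" and FE: "F \<subseteq> E" and KF: "K \<subseteq> F" "F \<noteq> K"
    and F_large: "card K * card V \<le> card F * card (fixed_points F)"
    using F unfolding good_def by blast+
  have Fc [simp]: "f \<in> carrier G" if "f \<in> F" for f
    using subgroup.mem_carrier[OF F_sub that] .
  have F_comm: "act f (act g v) = act g (act f v)" if "f \<in> F" "g \<in> F" "v \<in> V" for f g v
  proof -
    have "f \<otimes> g = g \<otimes> f" using E(2) FE that by blast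
    then show ?thesis using that by (simp flip: act_product)
  qed
  have fixV: "fixed_points H \<subseteq> V" for H by (auto simp: fixed_points_def)
  have finV: "finite V" by (rule finite_subset[OF subset fin])
  have finF: "finite F" by (rule finite_subset[OF subgroup.subset[OF F_sub] fin])
  have fin_fix: "finite (fixed_points H)" for H using finite_subset[OF fixV finV] .
  have step: "F \<subseteq> fixator {diff f v | f. f \<in> F}" if v: "v \<in> V" for v
  proof -
    define Fv where "Fv = F \<inter> fixator {diff f v | f. f \<in> F}"
    define Y where "Y = (\<lambda>(f, w). diff f v \<otimes> w) ` (F \<times> fixed_points F)"
    have fixed: "act f w = w" "diff f w = \<one>" if "f \<in> F" "w \<in> fixed_points F" for f w
      using that by (auto simp: fixed_points_def diff_eq_one_iff)
    have Fv_sub: "subgroup Fv G"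
      unfolding Fv_def using v F_sub by (intro subgroups_Inter_pair fixator_subgroup) auto
    have KFv: "K \<subseteq> Fv"
      using KF v by (auto simp: Fv_def K_def fixator_def)
    have Y: "Y \<subseteq> fixed_points Fv"
      using v by (auto simp: Y_def Fv_def fixed_points_def fixator_def act_mult)
    have "card (F \<times> fixed_points F) \<le> card Y * card Fv"
    proof (rule card_le_fibre_bound[of _ _ "\<lambda>(f, w). diff f v \<otimes> w"])
      fix a assume "a \<in> F \<times> fixed_points F"
      then obtain f0 w0 where a: "a = (f0, w0)" "f0 \<in> F" "w0 \<in> fixed_points F" by auto
      let ?A = "{x \<in> F \<times> fixed_points F.
        (case x of (f, w) \<Rightarrow> diff f v \<otimes> w) = (case a of (f, w) \<Rightarrow> diff f v \<otimes> w)}"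
      let ?h = "\<lambda>(f, w). f \<otimes> inv f0"
      have inj: "inj_on ?h ?A"
      proof (rule inj_onI)
        fix x y assume xy: "x \<in> ?A" "y \<in> ?A" "?h x = ?h y"
        obtain f w f' w' where xy': "x = (f, w)" "y = (f', w')" by fastforce
        have f: "f = f'" "f \<in> F" using xy xy' a by simp_all
        have "w \<in> V" "w' \<in> V" using xy xy' fixV by auto
        moreover have "diff f v \<otimes> w = diff f v \<otimes> w'" using xy(1,2) xy' f by simp
        ultimately have "w = w'" using f(2) v by simp
        then show "x = y" using xy' f by simp
      qed
      have "?h ` ?A \<subseteq> Fv"
      proof clarsimp
        fix f w assume fw: "f \<in> F" "w \<in> fixed_points F"
          "diff f v \<otimes> w = (case a of (f, w) \<Rightarrow> diff f v \<otimes> w)"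
        have wV: "w \<in> V" "w0 \<in> V" using fw a fixV by auto
        let ?g = "f \<otimes> inv f0"
        have g: "?g \<in> F" using fw a F_sub by (simp add: subgroup.m_closed subgroup.m_inv_closed)
        define u where "u = w0 \<otimes> inv w"
        have u: "u \<in> fixed_points F"
          using fw a wV by (auto simp: u_def fixed_points_def act_mult act_inverse)
        have uV: "u \<in> V" using wV by (simp add: u_def)
        have "diff f v = diff f v \<otimes> w \<otimes> inv w" using fw(1) wV v by (simp add: m_assoc)
        also have "\<dots> = diff f0 v \<otimes> w0 \<otimes> inv w" using fw(3) a(1) by simp
        also have "\<dots> = diff f0 v \<otimes> u" using a(2) wV v by (simp add: u_def m_assoc)
        finally have "act f v = act f0 v \<otimes> u"
          using fw a v uV by (simp add: act_eq m_assoc)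
        then have "act ?g v = v \<otimes> act (inv f0) u"
          using fw a v uV by (simp add: act_product act_mult)
        also have "act (inv f0) u = u"
          using act_inv_act(1)[of f0 u] fixed(1)[OF a(2) u] a uV by simp
        finally have gv: "act ?g v = v \<otimes> u" .
        have "act ?g (diff h v) = diff h v" if h: "h \<in> F" for h
        proof -
          have "act ?g (diff h v) = diff h (act ?g v)"
            using h g v F_comm[OF g h] by (intro diff_commute) auto
          also have "\<dots> = diff h v" using h v uV fixed(2)[OF h u] by (simp add: gv diff_mult)
          finally show ?thesis .
        qed
        then show "?g \<in> Fv" using g by (auto simp: Fv_def fixator_def)
      qed
      then show "card ?A \<le> card Fv"
        using inj finF by (intro card_inj_on_le) (auto simp: Fv_def)
    qed (use finF fin_fix in \<open>auto simp: Y_def\<close>)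
    then have count: "card F * card (fixed_points F) \<le> card Y * card Fv"
      by (simp add: card_cartesian_product)
    also have "\<dots> \<le> card (fixed_points Fv) * card Fv"
      using Y fin_fix by (simp add: card_mono)
    finally have Fv_large: "card K * card V \<le> card Fv * card (fixed_points Fv)"
      using F_large by (simp add: mult.commute)
    show ?thesis
    proof (cases "Fv = K")
      case False
      then have "good Fv" using Fv_sub KFv Fv_large FE by (auto simp: good_def Fv_def)
      then have "Fv = F" using F_min finF by (intro card_seteq) (auto simp: Fv_def)
      then show ?thesis by (auto simp: Fv_def)
    next
      case True
      have "\<one> \<in> K" using subgroup.one_closed[OF Fv_sub] True by simp
      then have "card K > 0" using finite_subset[OF KF(1) finF] by (auto simp: card_gt_0_iff)
      moreover have "card K * card V \<le> card K * card Y"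
        using le_trans[OF F_large count] True by (simp add: mult.commute)
      ultimately have "card V \<le> card Y" by simp
      then have "Y = V" by (intro card_seteq[OF finV subset_trans[OF Y fixV]])
      with v have "v \<in> Y" by simp
      then obtain f w where fw: "f \<in> F" "w \<in> fixed_points F" "v = diff f v \<otimes> w"
        unfolding Y_def by (elim imageE) auto
      define u where "u = diff f v"
      have uV: "u \<in> V" and wV: "w \<in> V" using fw v fixV by (auto simp: u_def)
      have "u = diff f (u \<otimes> w)" unfolding u_def by (rule arg_cong[OF fw(3)])
      then have "diff f u = u" using fw uV wV fixed(2)[OF fw(1,2)] by (simp add: diff_mult)
      then have fu: "act f u = u \<otimes> u" using fw uV by (simp add: act_eq)
      \<comment> \<open>\<open>f\<close> doubles \<open>u\<close>, and \<open>f\<^sup>p = 1\<close>; by Fermat \<open>2\<^sup>p\<close> is \<open>2\<close> modulo \<open>p\<close>, so \<open>u = 2u\<close>\<close>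
      have upow: "u [^] k \<in> V" for k :: nat using uV by (induction k) auto
      have "act (f [^] k) u = u [^] ((2::nat) ^ k)" for k :: nat
      proof (induction k)
        case 0
        then show ?case using uV by simp
      next
        case (Suc k)
        have pow: "act f (u [^] n) = act f u [^] n" for n :: nat
          using uV fw upow by (induction n) (auto simp: act_mult)
        have "act (f [^] Suc k) u = act f (u [^] ((2::nat) ^ k))"
          using Suc fw(1) uV by (simp add: act_product)
        also have "\<dots> = (u \<otimes> u) [^] ((2::nat) ^ k)" by (simp only: pow fu)
        also have "\<dots> = u [^] ((2::nat) ^ Suc k)"
          using uV by (simp add: pow_mult_distrib nat_pow_mult mult_2)
        finally show ?case .
      qed
      from this[of p] have "u = u [^] ((2::nat) ^ p)"
        using E_exp[of f] fw FE uV by auto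
      also have "\<dots> = u [^] ((2::nat) ^ p mod p + p * (2 ^ p div p))" by simp
      also have "\<dots> = u [^] ((2::nat) ^ p mod p)"
      proof -
        have "u [^] (p * b) = \<one>" for b :: nat
          using V_exp[OF uV] nat_pow_pow[of u p b] uV by simp
        then show ?thesis using uV nat_pow_mult[of u "2 ^ p mod p" "p * (2 ^ p div p)"] by simp
      qed
      also have "(2::nat) ^ p mod p = 2"
      proof -
        have p2: "p > 2" using p prime_ge_2_nat[of p] by (cases "p = 2") auto
        then have "[2 ^ (p - 1) = 1] (mod p)"
          by (intro fermat_theorem p) (auto dest: dvd_imp_le)
        then have "[2 * 2 ^ (p - 1) = 2 * 1] (mod p)" by (rule cong_scalar_left)
        then show ?thesis using p2 by (simp add: cong_def flip: power_Suc)
      qed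
      finally have "u = u \<otimes> u" using uV by (simp add: numeral_2_eq_2)
      then have "u = \<one>" using uV by simp
      then have "v \<in> fixed_points F" using fw(2,3) wV by (simp add: u_def)
      then have "F \<subseteq> Fv" using fixed(2) by (auto simp: Fv_def fixator_def)
      then show ?thesis by (auto simp: Fv_def)
    qed
  qed
  have "quadratic f" if "f \<in> F" for f
    using that step by (fastforce simp: quadratic_def fixator_def diff_eq_one_iff)
  moreover obtain f where "f \<in> F" "f \<notin> K" using KF by blast
  ultimately show ?thesis using FE by (auto simp: K_def)
qed

end

section \<open>The action on the centralizer of the Oliver subgroup\<close>

text \<open>All uses of the maximality of \<open>X\<close> go through this lemma. As \<open>z\<close> is central modulo \<open>X\<close>, the subgroup \<open>Q\<close>
generated by \<open>X\<close> and \<open>z\<close> is normal. The chain \<open>W\<close> bounds the iterated commutators with \<open>Q\<close>; its members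
being normal, it suffices to check commutators with the generators of \<open>Q\<close>. So \<open>Q\<close> prolongs a
series for \<open>X\<close> by one step.\<close>
lemma (in group) central_in_oliver_subgroup:
  fixes p :: nat
  defines "X \<equiv> oliver_subgroup p G"
  assumes fin: "finite (carrier G)" and p: "p > 1" and z: "z \<in> carrier G"
    and central: "\<And>s. s \<in> carrier G \<Longrightarrow> commutator G z s \<in> X"
    and W_normal: "\<And>j. W j \<lhd> G"
    and W_0: "Omega1 p G (centralizer G X) \<subseteq> W 0"
    and W_end: "W (p - 1) \<subseteq> {\<one>}"
    and W_step: "\<And>j w x. j < p - 1 \<Longrightarrow> w \<in> W j \<Longrightarrow> x \<in> insert z X \<Longrightarrow> commutator G w x \<in> W (Suc j)"
  shows "z \<in> X"
proof -
  have series: "has_oliver_series p G X"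
    unfolding X_def by (rule oliver_subgroup_greatest(1)[OF fin])
  interpret X: normal X G using series by (rule has_oliver_series_normal)
  \<comment> \<open>unlike \<open>insert z X\<close>, this generating set is invariant under conjugation\<close>
  define H where "H = X \<union> (X #> z)"
  define Q where "Q = generate G H"
  have H_sub: "H \<subseteq> carrier G"
    using X.subset r_coset_subset_G[OF X.subset z] by (auto simp: H_def)
  have coset: "X #> z = {x \<otimes> z | x. x \<in> X}" by (auto simp: r_coset_def)
  have zH: "z \<in> H" using z X.subgroup_axioms rcos_self[of z X] by (simp add: H_def)
  have Q_normal: "Q \<lhd> G"
    unfolding Q_def
  proof (rule normal_generateI[OF H_sub])
    fix h g assume h: "h \<in> H" and g: "g \<in> carrier G"
    show "g \<otimes> h \<otimes> inv g \<in> H"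
    proof (cases "h \<in> X")
      case True
      then show ?thesis using X.inv_op_closed2[OF g] by (simp add: H_def)
    next
      case False
      then obtain x where x: "x \<in> X" "h = x \<otimes> z" using h by (auto simp: H_def coset)
      have xc: "x \<in> carrier G" using x X.subset by blast
      define y where "y = z \<otimes> commutator G z (inv g) \<otimes> inv z"
      have "y \<in> X" unfolding y_def using central g z by (intro X.inv_op_closed2) auto
      moreover have "g \<otimes> x \<otimes> inv g \<in> X" using X.inv_op_closed2[OF g x(1)] .
      ultimately have "g \<otimes> x \<otimes> inv g \<otimes> y \<in> X" by (rule X.m_closed[rotated])
      moreover have "g \<otimes> h \<otimes> inv g = g \<otimes> x \<otimes> inv g \<otimes> y \<otimes> z"
        unfolding y_def x(2) using g z xc
        by (simp add: commutator_def m_assoc inv_mult_cancel mult_inv_cancel)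
      ultimately show ?thesis by (auto simp: H_def coset)
    qed
  qed
  have Q_sub: "Q \<subseteq> carrier G" using Q_normal normal_imp_subgroup subgroup.subset by blast
  have Q_step: "commutator G w q \<in> W (Suc j)" if "j < p - 1" "w \<in> W j" "q \<in> Q" for j w q
  proof -
    interpret Wj: normal "W j" G by (rule W_normal)
    interpret Ws: normal "W (Suc j)" G by (rule W_normal)
    have Wc [simp]: "w \<in> carrier G" if "w \<in> W j" for w using that Wj.subset by blast
    define T where "T = {q \<in> carrier G. \<forall>w\<in>W j. commutator G w q \<in> W (Suc j)}"
    have T_sub: "subgroup T G"
    proof (rule subgroupI)
      show "T \<noteq> {}"
        by (auto simp: T_def commutator_def intro!: exI[of _ \<one>])
    next
      fix q assume q: "q \<in> T"
      have "commutator G w (inv q) \<in> W (Suc j)" if w: "w \<in> W j" for w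
      proof -
        have "commutator G w (inv q) = q \<otimes> inv (commutator G w q) \<otimes> inv q"
          using q w by (simp add: T_def commutator_def inv_mult_group m_assoc mult_inv_cancel)
        also have "\<dots> \<in> W (Suc j)"
          using q w by (intro Ws.inv_op_closed2 Ws.m_inv_closed) (auto simp: T_def)
        finally show ?thesis .
      qed
      then show "inv q \<in> T" using q by (simp add: T_def)
    next
      fix q q' assume q: "q \<in> T" "q' \<in> T"
      have "commutator G w (q \<otimes> q') \<in> W (Suc j)" if w: "w \<in> W j" for w
      proof -
        have "commutator G w (q \<otimes> q') = commutator G w q' \<otimes> (inv q' \<otimes> commutator G w q \<otimes> q')"
          using q w by (simp add: T_def commutator_def inv_mult_group m_assoc mult_inv_cancel)
        also have "\<dots> \<in> W (Suc j)"
          using q w by (intro Ws.m_closed Ws.inv_op_closed1) (auto simp: T_def)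
        finally show ?thesis .
      qed
      then show "q \<otimes> q' \<in> T" using q by (simp add: T_def)
    qed (auto simp: T_def)
    have "insert z X \<subseteq> T"
      using W_step[OF that(1)] z X.subset by (auto simp: T_def)
    then have "H \<subseteq> T"
      using subgroup.m_closed[OF T_sub] by (auto simp: H_def coset)
    then have "Q \<subseteq> T" unfolding Q_def by (rule generate_subgroup_incl[OF _ T_sub])
    then show ?thesis using that by (auto simp: T_def)
  qed
  let ?O = "Omega1 p G (centralizer G X)"
  have "iterated_commutator G ?O Q j \<subseteq> W j" if "j \<le> p - 1" for j
    using that
  proof (induction j)
    case 0
    then show ?case using W_0 by simp
  next
    case (Suc j)
    then have "iterated_commutator G ?O Q j \<subseteq> W j" "j < p - 1" by auto
    then show ?case
      unfolding iterated_commutator.simps commutator_subgroup_def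
      using Q_step[of j] normal_imp_subgroup[OF W_normal[of "Suc j"]]
      by (intro generate_subgroup_incl) (auto simp: commutator_def)
  qed
  then have "iterated_commutator G ?O Q (p - 1) \<subseteq> {\<one>}" using W_end by blast
  moreover have "\<one> \<in> iterated_commutator G ?O Q (p - 1)"
    using p by (cases "p - 1") (auto simp: commutator_subgroup_def intro: generate.one)
  ultimately have "iterated_commutator G ?O Q (p - 1) = {\<one>}" by blast
  moreover have "X \<subseteq> Q" unfolding Q_def H_def by (auto intro: generate.incl)
  ultimately have "has_oliver_series p G Q"
    using has_oliver_series_step[OF series Q_normal] by blast
  then have "Q \<subseteq> X" unfolding X_def by (rule oliver_subgroup_greatest(2)[OF fin])
  then show ?thesis using generate.incl[OF zH] by (auto simp: Q_def)
qed

text \<open>The last assumption is the integral form of the logarithmic bound on the class. It is guarded because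
\<open>c - 1\<close> is truncated at \<open>c = 0\<close>, where the logarithmic bound gives nothing.\<close>
locale oliver_quotient = group G for G (structure) +
  fixes p :: nat and L :: "nat \<Rightarrow> 'a set" and c :: nat
  assumes p: "prime p" "odd p"
    and fin: "finite (carrier G)"
    and quotient: "nilpotent_quotient (oliver_subgroup p G) G L c"
    and class_bound: "0 < c \<Longrightarrow> 2 ^ (c - 1) + 2 \<le> p"
begin

definition X :: "'a set" where "X = oliver_subgroup p G"

definition C :: "'a set" where "C = centralizer G X"

text \<open>As \<open>C\<close> turns out to be abelian, this is \<open>Omega1 p G C\<close>, described by its elements instead of
generators.\<close>
definition V :: "'a set" where "V = {x \<in> C. x [^] p = \<one>}"

sublocale quot: nilpotent_quotient X G L c
  unfolding X_def by (rule quotient)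

lemma p_gt_2: "p > 2"
proof -
  have "p \<noteq> 2" using p(2) by auto
  then show ?thesis using prime_ge_2_nat[OF p(1)] by linarith
qed

lemma C_normal: "C \<lhd> G"
  unfolding C_def by (rule centralizer_normal[OF quot.normal_axioms])

lemma C_carrier [simp]: "x \<in> C \<Longrightarrow> x \<in> carrier G"
  unfolding C_def centralizer_def by blast

lemma X_carrier [simp]: "x \<in> X \<Longrightarrow> x \<in> carrier G"
  by (rule quot.mem_carrier)

lemma C_commute: "x \<in> C \<Longrightarrow> y \<in> X \<Longrightarrow> x \<otimes> y = y \<otimes> x"
  unfolding C_def centralizer_def by blast

text \<open>Otherwise there is \<open>z \<in> C\<close> outside \<open>X\<close> and central modulo \<open>X\<close>. Commutators of \<open>C\<close> with \<open>z\<close> and with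
\<open>X\<close> lie in \<open>C \<inter> X\<close>, which commutes with both \<open>X\<close> and \<open>z\<close>. So two steps reach the trivial group, and
\<open>2 \<le> p - 1\<close>.\<close>
lemma centralizer_in_oliver_subgroup: "C \<subseteq> X"
proof (rule ccontr)
  assume "\<not> C \<subseteq> X"
  interpret C: normal C G by (rule C_normal)
  obtain x where x: "x \<in> C" "x \<notin> X" using \<open>\<not> C \<subseteq> X\<close> by blast
  obtain z where z: "z \<in> carrier G" "z \<notin> X" "z \<in> C" "\<And>s. s \<in> carrier G \<Longrightarrow> commutator G z s \<in> X"
    using quot.descent[of x "\<lambda>_ y. y \<in> C", OF C_carrier[OF x(1)] x(2,1)] C.commutator_in_normal by blast
  define W where "W j = (if j = 0 then C else if j = 1 then C \<inter> X else {\<one>})" for j :: nat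
  have "z \<in> X"
    unfolding X_def
  proof (rule central_in_oliver_subgroup[OF fin, of p z W])
    show "p > 1" using p_gt_2 by simp
    show "W j \<lhd> G" for j
      using C_normal quot.normal_axioms by (simp add: W_def normal_subgroup_intersect one_is_normal)
    show "Omega1 p G (centralizer G (oliver_subgroup p G)) \<subseteq> W 0"
      using Omega1_subset[OF C.subgroup_axioms] by (simp add: W_def C_def X_def)
    have "p - 1 \<noteq> 0" "p - 1 \<noteq> 1" using p_gt_2 by linarith+
    then show "W (p - 1) \<subseteq> {\<one>}" unfolding W_def by simp
    fix j w y assume w: "w \<in> W j" and y: "y \<in> insert z (oliver_subgroup p G)"
    have y': "y = z \<or> y \<in> X" using y unfolding X_def by blast
    then have yc: "y \<in> carrier G" using z(1) X_carrier by blast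
    consider "j = 0" | "j = 1" | "j \<ge> 2" by linarith
    then show "commutator G w y \<in> W (Suc j)"
    proof cases
      case 1
      then have wC: "w \<in> C" using w by (simp add: W_def)
      have "commutator G w z \<in> X"
        using quot.m_inv_closed[OF z(4)[of w]] z wC by (simp add: inv_commutator)
      then have "commutator G w y \<in> X"
        using y' wC quot.commutator_in_normal' by auto
      then show ?thesis using C.commutator_in_normal[OF wC yc] 1 by (simp add: W_def)
    next
      case 2
      then have "w \<in> C" "w \<in> X" using w by (simp_all add: W_def)
      then have "w \<otimes> y = y \<otimes> w" using y' z(3) C_commute by metis
      then show ?thesis using 2 \<open>w \<in> C\<close> yc by (simp add: W_def commutator_eq_one)
    next
      case 3
      then show ?thesis using w yc by (simp add: W_def commutator_eq_one)
    qed
  qed (use z(1,4) in \<open>simp_all flip: X_def\<close>)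
  with z(2) show False by blast
qed

lemma V_sub_C: "V \<subseteq> C" by (auto simp: V_def)

lemma V_normal: "V \<lhd> G"
proof -
  interpret C: normal C G by (rule C_normal)
  have "subgroup V G"
  proof (rule subgroupI)
    show "x \<otimes> y \<in> V" if "x \<in> V" "y \<in> V" for x y
    proof -
      have xy: "x \<in> C" "y \<in> C" "x [^] p = \<one>" "y [^] p = \<one>" using that by (simp_all add: V_def)
      then have "x \<otimes> y = y \<otimes> x" using C_commute centralizer_in_oliver_subgroup by blast
      then have "(x \<otimes> y) [^] p = \<one>" using xy by (simp add: pow_mult_distrib)
      then show ?thesis using C.m_closed xy by (simp add: V_def)
    qed
    show "inv x \<in> V" if "x \<in> V" for x
      using that C.m_inv_closed by (simp add: V_def nat_pow_inv)
    have "\<one> \<in> V" using C.one_closed by (simp add: V_def)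
    then show "V \<noteq> {}" by blast
    show "V \<subseteq> carrier G" using C.subset by (auto simp: V_def)
  qed
  moreover have "g \<otimes> h \<otimes> inv g \<in> V" if g: "g \<in> carrier G" and h: "h \<in> V" for g h
  proof -
    have hc: "h \<in> carrier G" using h by (simp add: V_def)
    have "(g \<otimes> h \<otimes> inv g) [^] n = g \<otimes> h [^] n \<otimes> inv g" for n :: nat
      using g hc by (induction n) (simp_all add: m_assoc inv_mult_cancel)
    then show ?thesis using g h C.inv_op_closed2 by (simp add: V_def)
  qed
  ultimately show ?thesis by (simp add: normal_inv_iff)
qed

sublocale module: abelian_normal_subgroup V G
proof -
  interpret normal V G by (rule V_normal)
  show "abelian_normal_subgroup V G"
    using C_commute centralizer_in_oliver_subgroup V_sub_C by unfold_locales blast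
qed

lemma Omega1_sub_V: "Omega1 p G (centralizer G X) \<subseteq> V"
  unfolding Omega1_def
proof (rule generate_subgroup_incl[OF _ module.subgroup_axioms])
  have "x \<in> V" if "x \<in> C" "ord x = p" for x
    using pow_ord_eq_1[OF C_carrier[OF that(1)]] that by (simp add: V_def)
  then show "{x \<in> centralizer G X. ord x = p} \<subseteq> V" unfolding C_def by blast
qed

lemma commutator_V_X: "v \<in> V \<Longrightarrow> x \<in> X \<Longrightarrow> commutator G v x = \<one>"
  using V_sub_C C_commute[of v x] by (intro commutator_eq_one) auto

text \<open>An element \<open>z\<close> outside \<open>X\<close> that acts trivially on \<open>V\<close> can be chosen central modulo \<open>X\<close>, and then the
single step from \<open>V\<close> to the trivial group puts it into \<open>X\<close>.\<close>
lemma kernel: "X = module.fixator V"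
proof
  show "X \<subseteq> module.fixator V"
    using V_sub_C C_commute X_carrier unfolding module.fixator_eq_centralizer centralizer_def by (smt (verit) mem_Collect_eq subsetD subsetI)
  show "module.fixator V \<subseteq> X"
  proof (rule ccontr)
    assume "\<not> module.fixator V \<subseteq> X"
    interpret F: normal "module.fixator V" G
      unfolding module.fixator_eq_centralizer by (rule centralizer_normal[OF V_normal])
    obtain x where x: "x \<in> module.fixator V" "x \<notin> X"
      using \<open>\<not> module.fixator V \<subseteq> X\<close> by blast
    obtain z where z: "z \<in> carrier G" "z \<notin> X" "z \<in> module.fixator V"
      "\<And>s. s \<in> carrier G \<Longrightarrow> commutator G z s \<in> X"
      using quot.descent[of x "\<lambda>_ y. y \<in> module.fixator V", OF F.mem_carrier[OF x(1)] x(2,1)]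
        F.commutator_in_normal by blast
    define W where "W j = (if j = 0 then V else {\<one>})" for j :: nat
    have "z \<in> X"
      unfolding X_def
    proof (rule central_in_oliver_subgroup[OF fin, of p z W])
      show "p > 1" using p_gt_2 by simp
      show "W j \<lhd> G" for j by (simp add: W_def V_normal one_is_normal)
      show "Omega1 p G (centralizer G (oliver_subgroup p G)) \<subseteq> W 0"
        using Omega1_sub_V by (simp add: W_def X_def)
      show "W (p - 1) \<subseteq> {\<one>}" using p_gt_2 by (simp add: W_def)
      fix j w y assume w: "w \<in> W j" and y: "y \<in> insert z (oliver_subgroup p G)"
      have wV: "w \<in> V" using w by (auto simp: W_def split: if_splits)
      have "commutator G w z = \<one>"
      proof (rule commutator_eq_one)
        show "w \<otimes> z = z \<otimes> w"
          using z(3) wV unfolding module.fixator_eq_centralizer centralizer_def by (metis (mono_tags, lifting) mem_Collect_eq)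
      qed (use z(1) wV in simp_all)
      then have "commutator G w y = \<one>" using y wV commutator_V_X by (auto simp: X_def)
      then show "commutator G w y \<in> W (Suc j)" by (simp add: W_def)
    qed (use z(1,4) in \<open>simp_all flip: X_def\<close>)
    with z(2) show False by blast
  qed
qed

lemma V_exponent: "v \<in> V \<Longrightarrow> v [^] p = \<one>"
  by (simp add: V_def)

lemma no_2_torsion:
  assumes v: "v \<in> V" "v \<otimes> v = \<one>"
  shows "v = \<one>"
proof -
  obtain k where k: "p = Suc (2 * k)" using p(2) oddE by (metis Suc_eq_plus1)
  have "v [^] (2 * k) = (v [^] (2::nat)) [^] k" using v by (simp add: nat_pow_pow)
  also have "v [^] (2::nat) = \<one>" using v by (simp add: numeral_2_eq_2)
  finally show ?thesis using V_exponent[OF v(1)] v by (simp add: k)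
qed

sublocale nilpotent_action V X L c G
  using kernel no_2_torsion by unfold_locales

text \<open>The central \<open>z\<close> provided by a quadratic element satisfies \<open>(z - 1)\<^bsup>p-1\<^esup> = 0\<close> on \<open>V\<close>. The kernels of the
powers of \<open>z - 1\<close> are normal in \<open>G\<close>, because \<open>z\<close> commutes with the action of \<open>G\<close>, and they form the chain
that puts \<open>z\<close> into \<open>X\<close>.\<close>
lemma no_quadratic_element:
  assumes "module.quadratic s"
  shows "s \<in> X"
proof (rule ccontr)
  assume "s \<notin> X"
  from central_element_of_small_nilpotence[OF assms this]
  obtain m z where m: "m < c" and z: "z \<in> carrier G" "z \<notin> X"
    and central: "\<And>t. t \<in> carrier G \<Longrightarrow> commutator G z t \<in> X"
    and nil: "\<And>v. v \<in> V \<Longrightarrow> (module.diff z ^^ (2 ^ m + 1)) v = \<one>" by blast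
  have "(2::nat) ^ m \<le> 2 ^ (c - 1)" using m by (intro power_increasing) auto
  moreover have "2 ^ (c - 1) + 2 \<le> p" using class_bound m by simp
  ultimately have bound: "2 ^ m + 1 \<le> p - 1" by linarith
  define W where "W j = {v \<in> V. (module.diff z ^^ (p - 1 - j)) v = \<one>}" for j
  have "z \<in> X"
    unfolding X_def
  proof (rule central_in_oliver_subgroup[OF fin, of p z W])
    show "p > 1" using p_gt_2 by simp
    show "W j \<lhd> G" for j
    proof -
      have "subgroup (W j) G"
        by (rule subgroupI)
          (use z in \<open>auto simp: W_def module.diff_funpow_inverse module.diff_funpow_mult intro!: exI[of _ \<one>]\<close>)
      moreover have "g \<otimes> h \<otimes> inv g \<in> W j" if g: "g \<in> carrier G" and h: "h \<in> W j" for g h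
      proof -
        have eq: "g \<otimes> h \<otimes> inv g = module.act (inv g) h" using g by (simp add: module.act_def)
        have hV: "h \<in> V" and h1: "(module.diff z ^^ (p - 1 - j)) h = \<one>" using h by (auto simp: W_def)
        have "(module.diff z ^^ (p - 1 - j)) (module.act (inv g) h)
            = module.act (inv g) ((module.diff z ^^ (p - 1 - j)) h)"
          using z(1) g hV act_commute[of z "inv g"] central
          by (intro module.diff_funpow_commute[symmetric]) auto
        then show ?thesis using g hV unfolding eq h1 by (simp add: W_def)
      qed
      ultimately show ?thesis by (simp add: normal_inv_iff)
    qed
    have "v \<in> W 0" if v: "v \<in> V" for v
    proof -
      have split: "p - 1 = p - 1 - (2 ^ m + 1) + (2 ^ m + 1)" using bound by simp
      have "(module.diff z ^^ (p - 1)) v = \<one>"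
        by (subst split, subst funpow_add) (simp only: o_apply nil[OF v] module.diff_funpow_one[OF z(1)])
      then show ?thesis using v by (simp add: W_def)
    qed
    then show "Omega1 p G (centralizer G (oliver_subgroup p G)) \<subseteq> W 0"
      using Omega1_sub_V by (auto simp: X_def)
    show "W (p - 1) \<subseteq> {\<one>}" by (auto simp: W_def)
    fix j w y assume j: "j < p - 1" and w: "w \<in> W j" and y: "y \<in> insert z (oliver_subgroup p G)"
    have wV: "w \<in> V" and w1: "(module.diff z ^^ (p - 1 - j)) w = \<one>" using w by (auto simp: W_def)
    have "p - 1 - j = Suc (p - 1 - Suc j)" using j by simp
    then have "(module.diff z ^^ (p - 1 - Suc j)) (module.diff z w) = \<one>"
      using w1 by (simp add: funpow_swap1)
    then have "commutator G w z \<in> W (Suc j)"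
      using z wV by (simp add: W_def flip: module.diff_eq_commutator)
    moreover have "commutator G w y \<in> W (Suc j)" if "y \<in> X"
      using commutator_V_X[OF wV that] z by (simp add: W_def)
    ultimately show "commutator G w y \<in> W (Suc j)" using y by (auto simp: X_def)
  qed (use z(1) central in \<open>simp_all flip: X_def\<close>)
  with z(2) show False by blast
qed

text \<open>The subgroup \<open>(E \<inter> X) V\<close> is elementary abelian too, hence not larger than \<open>E\<close>. This is the inequality from
which a quadratic element outside \<open>X\<close> results when \<open>E\<close> is not contained in \<open>X\<close>.\<close>
theorem maximal_elementary_abelian_in_oliver_subgroup:
  assumes E: "elementary_abelian_subgroup p G E"
    and max: "\<And>F. elementary_abelian_subgroup p G F \<Longrightarrow> card F \<le> card E"
  shows "E \<subseteq> X"
proof (rule ccontr)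
  assume "\<not> E \<subseteq> X"
  have E_sub: "subgroup E G" and E_comm: "\<And>x y. x \<in> E \<Longrightarrow> y \<in> E \<Longrightarrow> x \<otimes> y = y \<otimes> x"
    and E_exp: "\<And>x. x \<in> E \<Longrightarrow> x [^] p = \<one>"
    using E unfolding elementary_abelian_subgroup_def by blast+
  have Ec [simp]: "x \<in> carrier G" if "x \<in> E" for x by (rule subgroup.mem_carrier[OF E_sub that])
  define K where "K = E \<inter> X"
  have K_sub: "subgroup K G"
    unfolding K_def by (rule subgroups_Inter_pair[OF E_sub quot.subgroup_axioms])
  have VK_comm: "v \<otimes> k = k \<otimes> v" if "v \<in> V" "k \<in> K" for v k
    using that V_sub_C C_commute unfolding K_def by blast
  have "elementary_abelian_subgroup p G (V <#> K)"
    unfolding elementary_abelian_subgroup_def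
  proof (intro conjI ballI)
    show "subgroup (V <#> K) G" by (rule mult_norm_subgroup[OF V_normal K_sub])
    fix x assume "x \<in> V <#> K"
    then obtain v k where x: "v \<in> V" "k \<in> K" "x = v \<otimes> k" by (auto simp: set_mult_def)
    have xc: "v \<in> carrier G" "k \<in> carrier G" using x by (auto simp: K_def)
    show "x [^] p = \<one>"
      using x xc VK_comm E_exp V_exponent by (simp add: pow_mult_distrib K_def)
    fix y assume "y \<in> V <#> K"
    then obtain v' k' where y: "v' \<in> V" "k' \<in> K" "y = v' \<otimes> k'" by (auto simp: set_mult_def)
    have yc: "v' \<in> carrier G" "k' \<in> carrier G" using y by (auto simp: K_def)
    have "x \<otimes> y = v \<otimes> (k \<otimes> v') \<otimes> k'" using x y xc yc by (simp add: m_assoc)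
    also have "\<dots> = v \<otimes> (v' \<otimes> k) \<otimes> k'" by (simp only: VK_comm[OF y(1) x(2)])
    also have "\<dots> = (v \<otimes> v') \<otimes> (k \<otimes> k')" using xc yc by (simp add: m_assoc)
    also have "\<dots> = (v' \<otimes> v) \<otimes> (k' \<otimes> k)"
      using module.V_comm[OF x(1) y(1)] E_comm[of k k'] x(2) y(2) by (simp add: K_def)
    also have "\<dots> = v' \<otimes> (v \<otimes> k') \<otimes> k" using xc yc by (simp add: m_assoc)
    also have "\<dots> = y \<otimes> x" unfolding VK_comm[OF x(1) y(2)] using x y xc yc by (simp add: m_assoc)
    finally show "x \<otimes> y = y \<otimes> x" .
  qed
  then have "card (V <#> K) \<le> card E" by (rule max)
  have "card V * card K \<le> card (V <#> K) * card (V \<inter> K)"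
    by (rule card_subgroup_product[OF fin module.subgroup_axioms K_sub])
  also have "\<dots> \<le> card E * card (module.fixed_points E)"
  proof (rule mult_le_mono[OF _ card_mono])
    show "V \<inter> K \<subseteq> module.fixed_points E"
    proof
      fix v assume v: "v \<in> V \<inter> K"
      have "module.act e v = v" if e: "e \<in> E" for e
      proof -
        have "v \<otimes> e = e \<otimes> v" using E_comm e v by (auto simp: K_def)
        then show ?thesis using e v by (simp add: module.act_def m_assoc inv_mult_cancel)
      qed
      then show "v \<in> module.fixed_points E" using v by (simp add: module.fixed_points_def)
    qed
    show "finite (module.fixed_points E)"
      using finite_subset[OF module.subset fin] by (simp add: module.fixed_points_def)
  qed fact
  finally have "card (E \<inter> module.fixator V) * card V \<le> card E * card (module.fixed_points E)"
    by (simp add: K_def mult.commute flip: kernel)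
  then obtain e where "e \<in> E" "module.quadratic e" "e \<notin> X"
    using module.quadratic_element_exists[OF p fin V_exponent E_sub E_comm E_exp]
      \<open>\<not> E \<subseteq> X\<close> kernel by auto
  then show False using no_quadratic_element by blast
qed

end

theorem theorem1:
  fixes S :: "('a, 'b) monoid_scheme" and p n c :: nat
  assumes "prime p" and "odd p"
    and "group S" and "finite (carrier S)" and "order S = p ^ n"
    and "nilpotent_of_class (S Mod oliver_subgroup p S) c"
    and "real c \<le> log 2 (real p - 2) + 1"
  shows "thompson_subgroup p S \<subseteq> oliver_subgroup p S"
proof -
  interpret group S by fact
  let ?X = "oliver_subgroup p S"
  let ?L = "\<lambda>j. {x \<in> carrier S. ?X #>\<^bsub>S\<^esub> x \<in> lower_central_series (S Mod ?X) j}"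
  have X_normal: "?X \<lhd> S"
    using oliver_subgroup_greatest(1)[OF assms(4)] by (rule has_oliver_series_normal)
  have p3: "p \<ge> 3" using assms(1,2) prime_ge_2_nat[of p] by (cases "p = 2") auto
  have bound: "2 ^ (c - 1) + 2 \<le> p" if "0 < c"
  proof -
    have "real (c - 1) \<le> log 2 (real p - 2)" using assms(7) that by (simp add: of_nat_diff)
    then have "2 powr real (c - 1) \<le> real p - 2"
      using p3 by (subst (asm) le_log_iff) auto
    then have "real (2 ^ (c - 1) + 2) \<le> real p" by (simp add: powr_realpow)
    then show ?thesis by (simp only: of_nat_le_iff)
  qed
  interpret oliver_quotient S p ?L c
    by (intro oliver_quotient.intro oliver_quotient_axioms.intro assms bound
        factor_group_nilpotent_quotient[OF X_normal])
  show ?thesis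
    unfolding thompson_subgroup_def
  proof (rule generate_subgroup_incl[OF _ normal_imp_subgroup[OF X_normal]])
    show "\<Union>{E. elementary_abelian_subgroup p S E \<and>
        (\<forall>F. elementary_abelian_subgroup p S F \<longrightarrow> card F \<le> card E)} \<subseteq> ?X"
      using maximal_elementary_abelian_in_oliver_subgroup unfolding X_def by blast
  qed
qed

end
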